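(* Let $X$ be an infinite-dimensional Banach space over $\mathbb{K}\in\{\mathbb{R},\mathbb{C}\}$. Then $X$ admits an equivalent norm $|||\cdot|||$ such that, for $Z=(X,|||\cdot|||)$, there exists a tensor \[ u\in \mathrm{INA}_\pi(Z\widehat{\otimes}_\pi Z)\setminus \mathrm{NA}_\pi(Z\widehat{\otimes}_\pi Z). \] Moreover, $u$ is witnessed by a nonatomic Radon probability measure, i.e. the measure $\mu$ on $B_Z\times B_Z$ in the definition of $u\in\mathrm{INA}_\pi(Z\widehat{\otimes}_\pi Z)$ can be chosen to be a nonatomic Radon probability measure.
   Context: For a Banach space $X$, $B_X$ denotes the closed unit ball. $X\widehat{\otimes}_\pi Y$ is the completed projective tensor product of Banach spaces $X,Y$ (over the same field), with projective norm $\|\cdot\|_\pi$. $\mathrm{NA}_\pi(X\widehat{\otimes}_\pi Y)$ is the set of $u\in X\widehat{\otimes}_\pi Y$ that can be written as $u=\sum_{n=1}^\infty \lambda_n x_n\otimes y_n$ with $(x_n,y_n)\in B_X\times B_Y$, $\lambda_n\ge 0$ and $\sum_{n=1}^\infty\lambda_n=\|u\|_\pi$. $\mathrm{INA}_\pi(X\widehat{\otimes}_\pi Y)$ is the set of $u\in X\widehat{\otimes}_\pi Y$ for which there is a finite positive Borel measure $\mu$ on $B_X\times B_Y$ (Borel $\sigma$-algebra of the product of the norm topologies) such that $\varphi:B_X\times B_Y\to X\widehat{\otimes}_\pi Y$, $\varphi(x,y)=x\otimes y$, is $\mu$-Bochner integrable, $u=\int_{B_X\times B_Y}\varphi\,d\mu$,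 and $\|u\|_\pi=\|\mu\|$, where $\|\mu\|=\mu(B_X\times B_Y)$. Such a $\mu$ is said to witness $u$. *)

theory Defs
  imports "HOL-Probability.Probability" "HOL-Library.Function_Algebras"
begin

text \<open>
  A norm is a function on a fixed vector space rather than a type class operation, because
  the space has to be renormed. The scalar multiplication is also explicit, so that the real
  and the complex case are instances of the same definitions.
\<close>

definition is_norm :: "('k::real_normed_field \<Rightarrow> 'a::ab_group_add \<Rightarrow> 'a) \<Rightarrow> ('a \<Rightarrow> real) \<Rightarrow> bool" where
  "is_norm sc N \<longleftrightarrow>
     (\<forall>x. N x \<ge> 0) \<and> (\<forall>x. N x = 0 \<longleftrightarrow> x = 0) \<and>
     (\<forall>x y. N (x + y) \<le> N x + N y) \<and> (\<forall>c x. N (sc c x) = norm c * N x)"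

definition equivalent_norms :: "('a \<Rightarrow> real) \<Rightarrow> ('a \<Rightarrow> real) \<Rightarrow> bool" where
  "equivalent_norms N N' \<longleftrightarrow>
     (\<exists>c C. c > 0 \<and> C > 0 \<and> (\<forall>x. c * N x \<le> N' x \<and> N' x \<le> C * N x))"

definition infinite_dim :: "('k::field \<Rightarrow> 'a::ab_group_add \<Rightarrow> 'a) \<Rightarrow> bool" where
  "infinite_dim sc \<longleftrightarrow> \<not> (\<exists>B. finite B \<and> module.span sc B = UNIV)"

definition norm_topology :: "('a::ab_group_add \<Rightarrow> real) \<Rightarrow> 'a topology" where
  "norm_topology N = Metric_space.mtopology UNIV (\<lambda>x y. N (x - y))"

definition unit_ball :: "('a \<Rightarrow> real) \<Rightarrow> 'a set" where
  "unit_ball N = {x. N x \<le> 1}"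

definition borel_of :: "'a topology \<Rightarrow> 'a measure" where
  "borel_of T = sigma (topspace T) {U. openin T U}"

definition radon_measure :: "'a topology \<Rightarrow> 'a measure \<Rightarrow> bool" where
  "radon_measure T M \<longleftrightarrow>
     sets M = sets (borel_of T) \<and>
     (\<forall>x\<in>topspace T. \<exists>U. openin T U \<and> x \<in> U \<and> emeasure M U < \<infinity>) \<and>
     (\<forall>A\<in>sets M. emeasure M A = (SUP K\<in>{K. compactin T K \<and> K \<subseteq> A}. emeasure M K))"

definition nonatomic :: "'a measure \<Rightarrow> bool" where
  "nonatomic M \<longleftrightarrow>
     \<not> (\<exists>A\<in>sets M. emeasure M A > 0 \<and>
          (\<forall>B\<in>sets M. B \<subseteq> A \<longrightarrow> emeasure M B = 0 \<or> emeasure M B = emeasure M A))"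


text \<open>
  \<open>V\<close> is a subspace of the ambient type and \<open>p\<close> a norm on \<open>V\<close>; the values of \<open>p\<close> outside \<open>V\<close>
  play no role. Points of the completion are classes of Cauchy sequences modulo null sequences.
\<close>

locale completion =
  fixes V :: "'v::ab_group_add set"
    and sc :: "'k::real_normed_field \<Rightarrow> 'v \<Rightarrow> 'v"
    and p :: "'v \<Rightarrow> real"
begin

definition cauchy_seqs :: "(nat \<Rightarrow> 'v) set" where
  "cauchy_seqs =
     {\<sigma>. range \<sigma> \<subseteq> V \<and> (\<forall>e>0. \<exists>M. \<forall>m\<ge>M. \<forall>n\<ge>M. p (\<sigma> m - \<sigma> n) < e)}"

definition null_rel :: "((nat \<Rightarrow> 'v) \<times> (nat \<Rightarrow> 'v)) set" where
  "null_rel = {(\<sigma>, \<tau>) \<in> cauchy_seqs \<times> cauchy_seqs. (\<lambda>n. p (\<sigma> n - \<tau> n)) \<longlonglongrightarrow> 0}"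

definition points :: "(nat \<Rightarrow> 'v) set set" where
  "points = cauchy_seqs // null_rel"

definition cls :: "(nat \<Rightarrow> 'v) \<Rightarrow> (nat \<Rightarrow> 'v) set" where
  "cls \<sigma> = null_rel `` {\<sigma>}"

definition rep :: "(nat \<Rightarrow> 'v) set \<Rightarrow> nat \<Rightarrow> 'v" where
  "rep a = (SOME \<sigma>. \<sigma> \<in> a)"

definition embed :: "'v \<Rightarrow> (nat \<Rightarrow> 'v) set" where
  "embed v = cls (\<lambda>_. v)"

definition cnorm :: "(nat \<Rightarrow> 'v) set \<Rightarrow> real" where
  "cnorm a = lim (\<lambda>n. p (rep a n))"

definition lincomb :: "'i set \<Rightarrow> ('i \<Rightarrow> 'k) \<Rightarrow> ('i \<Rightarrow> (nat \<Rightarrow> 'v) set) \<Rightarrow> (nat \<Rightarrow> 'v) set" where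
  "lincomb I c a = cls (\<lambda>n. \<Sum>i\<in>I. sc (c i) (rep (a i) n))"

definition cdist :: "(nat \<Rightarrow> 'v) set \<Rightarrow> (nat \<Rightarrow> 'v) set \<Rightarrow> real" where
  "cdist a b = cnorm (cls (\<lambda>n. rep a n - rep b n))"

definition simple_fun :: "'x measure \<Rightarrow> ('x \<Rightarrow> (nat \<Rightarrow> 'v) set) \<Rightarrow> bool" where
  "simple_fun M s \<longleftrightarrow> simple_function M s \<and> s ` space M \<subseteq> points"

definition simple_integral :: "'x measure \<Rightarrow> ('x \<Rightarrow> (nat \<Rightarrow> 'v) set) \<Rightarrow> (nat \<Rightarrow> 'v) set" where
  "simple_integral M s =
     lincomb (s ` space M) (\<lambda>a. of_real (measure M (s -` {a} \<inter> space M))) (\<lambda>a. a)"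

definition strongly_measurable :: "'x measure \<Rightarrow> ('x \<Rightarrow> (nat \<Rightarrow> 'v) set) \<Rightarrow> bool" where
  "strongly_measurable M f \<longleftrightarrow>
     (\<exists>s. (\<forall>i. simple_fun M (s i)) \<and> (AE x in M. (\<lambda>i. cdist (s i x) (f x)) \<longlonglongrightarrow> 0))"

text \<open>
  Only used for finite measures, so simple functions need no restriction on their support.
  The library's Bochner integral is not applicable: its codomain is a second countable type.
\<close>

definition has_bochner ::
  "'x measure \<Rightarrow> ('x \<Rightarrow> (nat \<Rightarrow> 'v) set) \<Rightarrow> (nat \<Rightarrow> 'v) set \<Rightarrow> bool" where
  "has_bochner M f u \<longleftrightarrow>
     f ` space M \<subseteq> points \<and> u \<in> points \<and> strongly_measurable M f \<and>
     (\<exists>s. (\<forall>i. simple_fun M (s i)) \<and>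
          (\<lambda>i. \<integral>\<^sup>+x. ennreal (cdist (s i x) (f x)) \<partial>M) \<longlonglongrightarrow> 0 \<and>
          (\<lambda>i. cdist (simple_integral M (s i)) u) \<longlonglongrightarrow> 0)"

end


text \<open>
  The algebraic tensor product is modelled as the span of the evaluations \<open>A \<mapsto> A x y\<close>
  in the space of linear functionals on the bilinear forms on \<open>X \<times> Y\<close>. A functional on the
  bilinear forms is represented by its extension by zero to all functions of two arguments.
\<close>

locale projective_tensor =
  fixes scX :: "'k::real_normed_field \<Rightarrow> 'a::ab_group_add \<Rightarrow> 'a" and NX :: "'a \<Rightarrow> real"
    and scY :: "'k \<Rightarrow> 'b::ab_group_add \<Rightarrow> 'b" and NY :: "'b \<Rightarrow> real"
begin

definition bilinear_forms :: "('a \<Rightarrow> 'b \<Rightarrow> 'k) set" where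
  "bilinear_forms =
     {A. (\<forall>y. Vector_Spaces.linear scX (*) (\<lambda>x. A x y)) \<and> (\<forall>x. Vector_Spaces.linear scY (*) (A x))}"

definition tensor :: "'a \<Rightarrow> 'b \<Rightarrow> ('a \<Rightarrow> 'b \<Rightarrow> 'k) \<Rightarrow> 'k" where
  "tensor x y = (\<lambda>A. if A \<in> bilinear_forms then A x y else 0)"

definition tensor_scale :: "'k \<Rightarrow> (('a \<Rightarrow> 'b \<Rightarrow> 'k) \<Rightarrow> 'k) \<Rightarrow> ('a \<Rightarrow> 'b \<Rightarrow> 'k) \<Rightarrow> 'k" where
  "tensor_scale c v = (\<lambda>A. c * v A)"

definition alg_tensor :: "(('a \<Rightarrow> 'b \<Rightarrow> 'k) \<Rightarrow> 'k) set" where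
  "alg_tensor = module.span tensor_scale {tensor x y | x y. True}"

definition proj_norm :: "(('a \<Rightarrow> 'b \<Rightarrow> 'k) \<Rightarrow> 'k) \<Rightarrow> real" where
  "proj_norm v =
     Inf {\<Sum>i<n. NX (x i) * NY (y i) | (n::nat) x y. v = (\<Sum>i<n. tensor (x i) (y i))}"

sublocale hat: completion alg_tensor tensor_scale proj_norm .

definition ball_topology :: "('a \<times> 'b) topology" where
  "ball_topology =
     prod_topology (subtopology (norm_topology NX) (unit_ball NX))
                   (subtopology (norm_topology NY) (unit_ball NY))"

definition elementary :: "'a \<Rightarrow> 'b \<Rightarrow> (nat \<Rightarrow> ('a \<Rightarrow> 'b \<Rightarrow> 'k) \<Rightarrow> 'k) set" where
  "elementary x y = hat.embed (tensor x y)"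

definition NA :: "(nat \<Rightarrow> ('a \<Rightarrow> 'b \<Rightarrow> 'k) \<Rightarrow> 'k) set set" where
  "NA = {u \<in> hat.points. \<exists>l x y.
     (\<forall>n. x n \<in> unit_ball NX \<and> y n \<in> unit_ball NY \<and> (l n :: real) \<ge> 0) \<and>
     (\<lambda>m. hat.cdist (hat.lincomb {..<m} (\<lambda>n. of_real (l n)) (\<lambda>n. elementary (x n) (y n))) u)
       \<longlonglongrightarrow> 0 \<and>
     l sums hat.cnorm u}"

definition witnesses :: "('a \<times> 'b) measure \<Rightarrow> (nat \<Rightarrow> ('a \<Rightarrow> 'b \<Rightarrow> 'k) \<Rightarrow> 'k) set \<Rightarrow> bool" where
  "witnesses M u \<longleftrightarrow>
     finite_measure M \<and> sets M = sets (borel_of ball_topology) \<and>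
     hat.has_bochner M (\<lambda>(x, y). elementary x y) u \<and>
     hat.cnorm u = measure M (unit_ball NX \<times> unit_ball NY)"

definition INA :: "(nat \<Rightarrow> ('a \<Rightarrow> 'b \<Rightarrow> 'k) \<Rightarrow> 'k) set set" where
  "INA = {u \<in> hat.points. \<exists>M. witnesses M u}"

end

text \<open>
  Every complex Banach space is a real one together with a compatible complex scalar
  multiplication, and \<open>sc\<close> is that multiplication.
\<close>

definition complex_banach :: "(complex \<Rightarrow> 'a::banach \<Rightarrow> 'a) \<Rightarrow> bool" where
  "complex_banach sc \<longleftrightarrow>
     vector_space sc \<and> (\<forall>r x. sc (complex_of_real r) x = r *\<^sub>R x) \<and> is_norm sc norm"

end

theory Submission
  imports Defs
begin

text \<open>
  Take a biorthogonal system \<open>(e\<^sub>n, g\<^sub>n)\<close> with rapidly decreasing \<open>e\<^sub>n\<close> and the moment curve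
  \<open>k(t) = \<Sum>\<^sub>n t\<^sup>n e\<^sub>n\<close> for \<open>0 \<le> t \<le> 1\<close>, so that \<open>g\<^sub>n(k(t)) = t\<^sup>n\<close>. The new unit ball is the closed
  absolutely convex hull of the curve and a small ball. The bilinear form
  \<open>A = g\<^sub>0 \<otimes> g\<^sub>0 - g\<^sub>2 \<otimes> g\<^sub>0 - g\<^sub>0 \<otimes> g\<^sub>2 + 2 g\<^sub>1 \<otimes> g\<^sub>1\<close> satisfies \<open>A(k(s), k(t)) = 1 - (s - t)\<^sup>2\<close>. It has norm one and
  attains it, up to scalar factors, only at the pairs \<open>(k(s), k(s))\<close>, as far as bounded functionals can tell.
  Hence \<open>u = \<integral> k(t) \<otimes> k(t) dt\<close> has norm one, and a norm-attaining series for \<open>u\<close> would have to be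
  of the form \<open>\<Sum>\<^sub>n \<lambda>\<^sub>n k(s\<^sub>n) \<otimes> k(s\<^sub>n)\<close>. Comparing moments, Lebesgue measure would then be purely atomic;
  testing with \<open>(1 - (t - a)\<^sup>2)\<^sup>j\<close> for \<open>j \<rightarrow> \<infinity>\<close> at an atom \<open>a\<close> gives the contradiction.
\<close>

subsection \<open>Norming functionals\<close>

text \<open>Contacts are pinned to the diagonal by a comparison of orders: a bounded functional
  vanishing at k(s) is of first order in |s - t| along the curve, while A(k(s), k(t)) drops from 1
  to second order, so a small multiple of the functional can be added almost for free. The small
  ball makes the new norm equivalent to the old one, but it could create contacts of its own. Its
  radius 1/D is chosen so that every form A(k(s), .) is at most 1/2 on it. All powers t^n are put on
  the curve because finite combinations of the g_n then realise every polynomial in t as a bounded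
  functional, in particular the bumps used against an atom. The tensor u is the class of the Riemann
  sums of k(t) (x) k(t), each of projective norm exactly one. A functional on the completion is
  never extended to limits: bounded bilinear forms are applied to algebraic differences "partial sum
  minus Riemann sum", and limits are taken in the resulting inequalities.\<close>

definition sublinear :: "('a::real_vector \<Rightarrow> real) \<Rightarrow> bool" where
  "sublinear q \<longleftrightarrow> (\<forall>x y. q (x + y) \<le> q x + q y) \<and> (\<forall>r>0. \<forall>x. q (r *\<^sub>R x) \<le> r * q x)"

lemma sublinear_add: "sublinear q \<Longrightarrow> q (x + y) \<le> q x + q y"
  and sublinear_scale_le: "sublinear q \<Longrightarrow> r > 0 \<Longrightarrow> q (r *\<^sub>R x) \<le> r * q x"
  by (auto simp: sublinear_def)

lemma sublinear_0: assumes "sublinear q" shows "q 0 = 0"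
  using sublinear_scale_le[OF assms, of 2 0] sublinear_scale_le[OF assms, of "1/2" 0] by simp

text \<open>The definition asks only for an inequality with \<open>r > 0\<close>, the form that
  infima inherit directly. Applying it to \<open>inverse r\<close> gives the reverse
  inequality.\<close>

lemma sublinear_scale:
  assumes "sublinear q" "r \<ge> 0"
  shows "q (r *\<^sub>R x) = r * q x"
proof (cases "r = 0")
  case False
  then have "r > 0" using assms by simp
  then have "q x \<le> inverse r * q (r *\<^sub>R x)"
    using sublinear_scale_le[OF assms(1), of "inverse r" "r *\<^sub>R x"] by simp
  then have "r * q x \<le> q (r *\<^sub>R x)" using \<open>r > 0\<close> by (simp add: field_simps)
  then show ?thesis using sublinear_scale_le[OF assms(1) \<open>r > 0\<close>, of x] by linarith
qed (simp add: sublinear_0[OF assms(1)])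

lemma sublinear_minus: assumes "sublinear q" shows "- q (- x) \<le> q x"
  using sublinear_add[OF assms, of x "- x"] sublinear_0[OF assms] by simp

text \<open>For sublinear \<open>q\<close> this is the largest sublinear functional below
  \<open>q\<close> whose value at \<open>- a\<close> is at most \<open>- q a\<close>. A linear
  functional below it must agree with \<open>q\<close> at \<open>a\<close>.\<close>

definition sublinear_shrink :: "('a::real_vector \<Rightarrow> real) \<Rightarrow> 'a \<Rightarrow> 'a \<Rightarrow> real" where
  "sublinear_shrink q a x = (INF r\<in>{0..}. q (x + r *\<^sub>R a) - r * q a)"

lemma sublinear_shrink_le:
  assumes q: "sublinear q" and r: "r \<ge> 0"
  shows "sublinear_shrink q a x \<le> q (x + r *\<^sub>R a) - r * q a"
proof -
  \<comment> \<open>A lower bound independent of \<open>r\<close>, so that the real infimum is a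
    genuine one.\<close>
  have "- q (- x) \<le> q (x + r *\<^sub>R a) - r * q a" if "r \<ge> 0" for r
    using sublinear_add[OF q, of "x + r *\<^sub>R a" "- x"] sublinear_scale[OF q that, of a] by simp
  then have "bdd_below ((\<lambda>r. q (x + r *\<^sub>R a) - r * q a) ` {0..})"
    by (auto intro!: bdd_belowI)
  then show ?thesis
    unfolding sublinear_shrink_def using r by (auto intro: cINF_lower)
qed

lemma sublinear_shrink_greatest:
  assumes "\<And>r. r \<ge> 0 \<Longrightarrow> c \<le> q (x + r *\<^sub>R a) - r * q a"
  shows "c \<le> sublinear_shrink q a x"
  unfolding sublinear_shrink_def by (intro cINF_greatest) (use assms in auto)

lemma sublinear_shrink:
  assumes q: "sublinear q"
  shows "sublinear (sublinear_shrink q a)"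
  unfolding sublinear_def
proof (intro conjI allI impI)
  fix x y
  \<comment> \<open>Parameters \<open>r\<close> and \<open>s\<close> for the two summands add up to
    an admissible parameter for the sum; the two infima are then taken one after the other.\<close>
  have "sublinear_shrink q a (x + y) - (q (y + s *\<^sub>R a) - s * q a) \<le> q (x + r *\<^sub>R a) - r * q a"
    if "r \<ge> 0" "s \<ge> 0" for r s
    using sublinear_shrink_le[OF q, of "r + s" a "x + y"] that
      sublinear_add[OF q, of "x + r *\<^sub>R a" "y + s *\<^sub>R a"] by (simp add: algebra_simps)
  then have "sublinear_shrink q a (x + y) - (q (y + s *\<^sub>R a) - s * q a) \<le> sublinear_shrink q a x"
    if "s \<ge> 0" for s
    using that by (intro sublinear_shrink_greatest) auto
  then have "sublinear_shrink q a (x + y) - sublinear_shrink q a x \<le> sublinear_shrink q a y"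
    by (intro sublinear_shrink_greatest) (auto simp: algebra_simps)
  then show "sublinear_shrink q a (x + y) \<le> sublinear_shrink q a x + sublinear_shrink q a y" by simp
next
  fix c :: real and x assume c: "c > 0"
  have "sublinear_shrink q a (c *\<^sub>R x) / c \<le> q (x + r *\<^sub>R a) - r * q a" if "r \<ge> 0" for r
  proof -
    have "sublinear_shrink q a (c *\<^sub>R x) \<le> q (c *\<^sub>R (x + r *\<^sub>R a)) - (c * r) * q a"
      using sublinear_shrink_le[OF q, of "c * r" a "c *\<^sub>R x"] that c by (simp add: algebra_simps)
    also have "\<dots> = c * (q (x + r *\<^sub>R a) - r * q a)"
      using sublinear_scale[OF q, of c "x + r *\<^sub>R a"] c by (simp only: right_diff_distrib mult.assoc)
    finally show ?thesis using c by (simp add: field_simps)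
  qed
  then have "sublinear_shrink q a (c *\<^sub>R x) / c \<le> sublinear_shrink q a x"
    by (intro sublinear_shrink_greatest) auto
  then show "sublinear_shrink q a (c *\<^sub>R x) \<le> c * sublinear_shrink q a x"
    using c by (simp add: field_simps)
qed

text \<open>The pointwise infimum works. It is finite because \<open>- p (- x)\<close> bounds every
  member from below, and subadditive because the chain supplies one member below both the one chosen
  for \<open>x\<close> and the one chosen for \<open>y\<close>.\<close>

lemma sublinear_chain_lower_bound:
  fixes p :: "'a::real_vector \<Rightarrow> real"
  assumes C: "\<And>q. q \<in> C \<Longrightarrow> sublinear q \<and> q \<le> p" and ne: "C \<noteq> {}"
    and chain: "\<And>q q'. q \<in> C \<Longrightarrow> q' \<in> C \<Longrightarrow> q \<le> q' \<or> q' \<le> q"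
  shows "\<exists>u. sublinear u \<and> (\<forall>q\<in>C. u \<le> q)"
proof -
  define u where "u x = (INF q\<in>C. q x)" for x
  have "- p (- x) \<le> q x" if "q \<in> C" for q x
    using sublinear_minus[of q x] C[OF that] by (auto simp: le_fun_def intro: order_trans[OF le_imp_neg_le])
  then have "bdd_below ((\<lambda>q. q x) ` C)" for x
    by (auto intro!: bdd_belowI)
  then have u_le: "u x \<le> q x" if "q \<in> C" for q x
    unfolding u_def using that by (auto intro: cINF_lower)
  have u_ge: "c \<le> u x" if "\<And>q. q \<in> C \<Longrightarrow> c \<le> q x" for c x
    unfolding u_def using ne that by (auto intro: cINF_greatest)
  have "u (x + y) \<le> u x + u y" for x y
  proof -
    have "u (x + y) \<le> q x + q' y" if "q \<in> C" "q' \<in> C" for q q'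
    proof -
      obtain r where r: "r \<in> C" "r \<le> q" "r \<le> q'" using chain \<open>q \<in> C\<close> \<open>q' \<in> C\<close> by blast
      have "u (x + y) \<le> r (x + y)" by (rule u_le[OF r(1)])
      also have "\<dots> \<le> r x + r y" using C[OF r(1)] by (auto intro: sublinear_add)
      also have "\<dots> \<le> q x + q' y" using r by (auto simp: le_fun_def intro: add_mono)
      finally show ?thesis .
    qed
    then have "u (x + y) - q' y \<le> u x" if "q' \<in> C" for q' using that by (intro u_ge) (auto simp: algebra_simps)
    then have "u (x + y) - u x \<le> u y" by (intro u_ge) (auto simp: algebra_simps)
    then show ?thesis by simp
  qed
  moreover have "u (c *\<^sub>R x) \<le> c * u x" if "c > 0" for c x
  proof -
    have "u (c *\<^sub>R x) / c \<le> u x"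
    proof (rule u_ge)
      fix q assume "q \<in> C"
      then have "u (c *\<^sub>R x) \<le> c * q x"
        using u_le[of q "c *\<^sub>R x"] C[of q] sublinear_scale_le[of q c x] that by auto
      then show "u (c *\<^sub>R x) / c \<le> q x" using that by (simp add: field_simps)
    qed
    then show ?thesis using that by (simp add: field_simps)
  qed
  ultimately show ?thesis using u_le by (intro exI[of _ u]) (auto simp: sublinear_def le_fun_def)
qed

lemma minimal_sublinear_exists:
  fixes p :: "'a::real_vector \<Rightarrow> real"
  assumes p: "sublinear p"
  shows "\<exists>m. sublinear m \<and> m \<le> p \<and> (\<forall>q. sublinear q \<longrightarrow> q \<le> m \<longrightarrow> q = m)"
proof -
  let ?A = "{q. sublinear q \<and> q \<le> p}"
  \<comment> \<open>Zorn yields maximal elements, so the order is reversed; the empty chain is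
    bounded by \<open>p\<close> itself.\<close>
  have "\<exists>m\<in>?A. \<forall>a\<in>?A. m \<ge> a \<longrightarrow> a = m"
  proof (rule predicate_Zorn)
    show "partial_order_on ?A (relation_of (\<lambda>x y. x \<ge> y) ?A)"
      by (rule partial_order_on_relation_ofI) auto
  next
    fix C assume "C \<in> Chains (relation_of (\<lambda>x y. x \<ge> y) ?A)"
    then have C: "q \<in> C \<Longrightarrow> sublinear q \<and> q \<le> p"
      and chain: "q \<in> C \<Longrightarrow> q' \<in> C \<Longrightarrow> q \<le> q' \<or> q' \<le> q" for q q'
      by (auto simp: Chains_def relation_of_def)
    show "\<exists>u\<in>?A. \<forall>a\<in>C. a \<ge> u"
    proof (cases "C = {}")
      case False
      then obtain u where u: "sublinear u" "\<forall>q\<in>C. u \<le> q"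
        using sublinear_chain_lower_bound[of C p] C chain by blast
      moreover have "u \<le> p" using False u C by (meson ex_in_conv order_trans)
      ultimately show ?thesis by auto
    qed (use p in auto)
  qed
  then show ?thesis by (auto intro: order_trans)
qed

text \<open>A minimal sublinear functional is linear, since shrinking it along any vector does not change it.\<close>

theorem hahn_banach_norming:
  fixes x0 :: "'a::real_normed_vector"
  shows "\<exists>f::'a \<Rightarrow> real. linear f \<and> (\<forall>x. \<bar>f x\<bar> \<le> norm x) \<and> f x0 = norm x0"
proof -
  have "sublinear (norm :: 'a \<Rightarrow> real)"
    by (auto simp: sublinear_def norm_triangle_ineq)
  \<comment> \<open>Minimising below the shrunk norm instead of \<open>norm\<close> builds in that
    \<open>f (- x0)\<close> is at most \<open>- norm x0\<close>, which gives attainment at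
    \<open>x0\<close>.\<close>
  then have "sublinear (sublinear_shrink norm x0)"
    by (rule sublinear_shrink)
  then obtain f where f: "sublinear f" and f_le: "f \<le> sublinear_shrink norm x0"
    and min: "\<And>q. sublinear q \<Longrightarrow> q \<le> f \<Longrightarrow> q = f"
    using minimal_sublinear_exists by blast
  have shrink_norm: "sublinear_shrink norm x0 x \<le> norm (x + r *\<^sub>R x0) - r * norm x0" if "r \<ge> 0" for r x
    using sublinear_shrink_le \<open>sublinear norm\<close> that by blast
  have f_norm: "f x \<le> norm x" for x
    using f_le shrink_norm[of 0 x] by (auto simp: le_fun_def intro: order_trans)
  have add: "f (x + a) = f x + f a" for x a
  proof -
    have "sublinear_shrink f a \<le> f"
      using sublinear_shrink_le[OF f, of 0 a] by (auto simp: le_fun_def)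
    then have "sublinear_shrink f a = f" using min sublinear_shrink[OF f] by blast
    then have "f x \<le> f (x + a) - f a" using sublinear_shrink_le[OF f, of 1 a x] by simp
    then show ?thesis using sublinear_add[OF f, of x a] by simp
  qed
  have neg: "f (- x) = - f x" for x using add[of x "- x"] sublinear_0[OF f] by simp
  have "linear f"
  proof (rule linearI)
    fix r x
    show "f (r *\<^sub>R x) = r *\<^sub>R f x"
      using sublinear_scale[OF f, of r x] sublinear_scale[OF f, of "- r" x] neg[of "r *\<^sub>R x"]
      by (cases "r \<ge> 0") auto
  qed (rule add)
  moreover have "\<bar>f x\<bar> \<le> norm x" for x
    using f_norm[of x] f_norm[of "- x"] neg[of x] by auto
  moreover have "f x0 = norm x0"
  proof -
    have "f (- x0) \<le> - norm x0"
      using f_le shrink_norm[of 1 "- x0"] by (auto simp: le_fun_def intro: order_trans)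
    then show ?thesis using neg[of x0] f_norm[of x0] by simp
  qed
  ultimately show ?thesis by blast
qed

subsection \<open>Completions of seminormed spaces\<close>

text \<open>A seminorm suffices because \<open>null_rel\<close> identifies points at distance zero.
  Homogeneity is an inequality, since that is what an infimum over representations yields at
  once.\<close>

locale seminorm_completion = completion V sc p
  for V :: "'v::ab_group_add set" and sc :: "'k::real_normed_field \<Rightarrow> 'v \<Rightarrow> 'v" and p :: "'v \<Rightarrow> real" +
  assumes vector_space_sc: "vector_space sc"
    and zero_in: "0 \<in> V"
    and add_in: "v \<in> V \<Longrightarrow> w \<in> V \<Longrightarrow> v + w \<in> V"
    and scale_in: "v \<in> V \<Longrightarrow> sc c v \<in> V"
    and p_triangle: "v \<in> V \<Longrightarrow> w \<in> V \<Longrightarrow> p (v + w) \<le> p v + p w"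
    and p_scale_le: "v \<in> V \<Longrightarrow> p (sc c v) \<le> norm c * p v"
begin

interpretation sc: vector_space sc
  by (rule vector_space_sc)

lemma minus_in: "v \<in> V \<Longrightarrow> - v \<in> V"
  using scale_in[of v "-1"] by (simp add: sc.scale_minus_left)

lemma diff_in: "v \<in> V \<Longrightarrow> w \<in> V \<Longrightarrow> v - w \<in> V"
  using add_in[of v "- w"] minus_in by simp

lemma sum_in: "(\<And>i. i \<in> I \<Longrightarrow> f i \<in> V) \<Longrightarrow> sum f I \<in> V"
  by (induction I rule: infinite_finite_induct) (auto simp: zero_in add_in)

lemma p_zero: "p 0 = 0"
  using p_scale_le[OF zero_in, of 0] p_triangle[OF zero_in zero_in] by simp

lemma p_minus: assumes "v \<in> V" shows "p (- v) = p v"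
  using p_scale_le[OF assms, of "-1"] p_scale_le[OF minus_in[OF assms], of "-1"]
  by (simp add: sc.scale_minus_left)

lemma p_nonneg: assumes "v \<in> V" shows "p v \<ge> 0"
  using p_triangle[OF assms minus_in[OF assms]] p_zero p_minus[OF assms] by simp

lemma p_diff_commute: "v \<in> V \<Longrightarrow> w \<in> V \<Longrightarrow> p (v - w) = p (w - v)"
  using p_minus[OF diff_in, of v w] by simp

lemma p_diff_triangle:
  "u \<in> V \<Longrightarrow> v \<in> V \<Longrightarrow> w \<in> V \<Longrightarrow> p (u - w) \<le> p (u - v) + p (v - w)"
  using p_triangle[of "u - v" "v - w"] diff_in by simp

lemma p_reverse_triangle:
  assumes "v \<in> V" "w \<in> V"
  shows "\<bar>p v - p w\<bar> \<le> p (v - w)"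
  using p_triangle[of "v - w" w] p_triangle[of "w - v" v] p_diff_commute[of v w] diff_in assms by auto

lemma p_sum_le: "(\<And>i. i \<in> I \<Longrightarrow> f i \<in> V) \<Longrightarrow> p (sum f I) \<le> (\<Sum>i\<in>I. p (f i))"
proof (induction I rule: infinite_finite_induct)
  case (insert x F)
  then show ?case using p_triangle[of "f x" "sum f F"] sum_in[of F f] by auto
qed (auto simp: p_zero)

lemma cauchy_seqs_in: "\<sigma> \<in> cauchy_seqs \<Longrightarrow> \<sigma> n \<in> V"
  by (auto simp: cauchy_seqs_def)

lemma cauchy_seqsD:
  "\<sigma> \<in> cauchy_seqs \<Longrightarrow> e > 0 \<Longrightarrow> \<exists>M. \<forall>m\<ge>M. \<forall>n\<ge>M. p (\<sigma> m - \<sigma> n) < e"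
  by (auto simp: cauchy_seqs_def)

lemma const_cauchy: "v \<in> V \<Longrightarrow> (\<lambda>_. v) \<in> cauchy_seqs"
  by (auto simp: cauchy_seqs_def p_zero)

lemma equiv_null_rel: "equiv cauchy_seqs null_rel"
proof (rule equivI)
  show "null_rel \<subseteq> cauchy_seqs \<times> cauchy_seqs" by (auto simp: null_rel_def)
  show "refl_on cauchy_seqs null_rel"
    by (auto simp: refl_on_def null_rel_def p_zero)
  show "sym null_rel"
    by (rule symI) (auto simp: null_rel_def p_diff_commute[OF cauchy_seqs_in cauchy_seqs_in])
  show "trans null_rel"
  proof (rule transI)
    fix \<rho> \<sigma> \<tau> assume "(\<rho>, \<sigma>) \<in> null_rel" "(\<sigma>, \<tau>) \<in> null_rel"
    then have m: "\<rho> \<in> cauchy_seqs" "\<sigma> \<in> cauchy_seqs" "\<tau> \<in> cauchy_seqs"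
      and "(\<lambda>n. p (\<rho> n - \<sigma> n) + p (\<sigma> n - \<tau> n)) \<longlonglongrightarrow> 0"
      by (auto simp: null_rel_def intro: tendsto_add_zero)
    then have "(\<lambda>n. p (\<rho> n - \<tau> n)) \<longlonglongrightarrow> 0"
      by (elim tendsto_sandwich[OF _ _ tendsto_const, rotated 2])
        (simp_all add: p_nonneg p_diff_triangle diff_in cauchy_seqs_in)
    then show "(\<rho>, \<tau>) \<in> null_rel" using m by (auto simp: null_rel_def)
  qed
qed

lemma cls_in_points: "\<sigma> \<in> cauchy_seqs \<Longrightarrow> cls \<sigma> \<in> points"
  by (auto simp: points_def cls_def intro: quotientI)

text \<open>\<open>cnorm\<close>, \<open>cdist\<close> and \<open>lincomb\<close> go through
  representatives picked by \<open>SOME\<close>. This null difference is what lets any other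
  sequence of the class replace them.\<close>

lemma rep_cls:
  assumes "\<sigma> \<in> cauchy_seqs"
  shows "rep (cls \<sigma>) \<in> cauchy_seqs" "(\<lambda>n. p (\<sigma> n - rep (cls \<sigma>) n)) \<longlonglongrightarrow> 0"
proof -
  have "\<sigma> \<in> cls \<sigma>"
    unfolding cls_def by (rule equiv_class_self[OF equiv_null_rel assms])
  then have "rep (cls \<sigma>) \<in> cls \<sigma>" unfolding rep_def by (rule someI[where P = "\<lambda>\<sigma>'. \<sigma>' \<in> cls \<sigma>"])
  then show "rep (cls \<sigma>) \<in> cauchy_seqs" "(\<lambda>n. p (\<sigma> n - rep (cls \<sigma>) n)) \<longlonglongrightarrow> 0"
    by (auto simp: cls_def null_rel_def)
qed

lemma cls_eqI:
  "\<sigma> \<in> cauchy_seqs \<Longrightarrow> \<tau> \<in> cauchy_seqs \<Longrightarrow> (\<lambda>n. p (\<sigma> n - \<tau> n)) \<longlonglongrightarrow> 0 \<Longrightarrow> cls \<sigma> = cls \<tau>"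
  unfolding cls_def by (rule equiv_class_eq[OF equiv_null_rel]) (auto simp: null_rel_def)

lemma cauchyI_null_diff:
  assumes \<sigma>: "\<sigma> \<in> cauchy_seqs" and \<tau>: "\<And>n. \<tau> n \<in> V" and lim: "(\<lambda>n. p (\<sigma> n - \<tau> n)) \<longlonglongrightarrow> 0"
  shows "\<tau> \<in> cauchy_seqs"
  unfolding cauchy_seqs_def
proof (intro CollectI conjI allI impI)
  show "range \<tau> \<subseteq> V" using \<tau> by auto
  fix e :: real assume e: "e > 0"
  obtain M where M: "\<And>m n. m \<ge> M \<Longrightarrow> n \<ge> M \<Longrightarrow> p (\<sigma> m - \<sigma> n) < e / 3"
    using cauchy_seqsD[OF \<sigma>, of "e / 3"] e by (metis divide_pos_pos zero_less_numeral)
  obtain L where L: "\<And>n. n \<ge> L \<Longrightarrow> p (\<sigma> n - \<tau> n) < e / 3"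
    using order_tendstoD(2)[OF lim, of "e / 3"] e by (auto simp: eventually_sequentially)
  show "\<exists>M. \<forall>m\<ge>M. \<forall>n\<ge>M. p (\<tau> m - \<tau> n) < e"
  proof (intro exI[of _ "max M L"] allI impI)
    fix m n assume mn: "max M L \<le> m" "max M L \<le> n"
    have in_V: "\<sigma> m \<in> V" "\<sigma> n \<in> V" "\<tau> m \<in> V" "\<tau> n \<in> V"
      using \<tau> cauchy_seqs_in[OF \<sigma>] by auto
    have "p (\<tau> m - \<tau> n) \<le> p (\<tau> m - \<sigma> m) + (p (\<sigma> m - \<sigma> n) + p (\<sigma> n - \<tau> n))"
      using p_diff_triangle[of "\<tau> m" "\<sigma> m" "\<tau> n"] p_diff_triangle[of "\<sigma> m" "\<sigma> n" "\<tau> n"] in_V by auto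
    also have "\<dots> < e / 3 + (e / 3 + e / 3)"
      using M[of m n] L[of m] L[of n] mn p_diff_commute[of "\<tau> m" "\<sigma> m"] in_V
      by (intro add_strict_mono) auto
    finally show "p (\<tau> m - \<tau> n) < e" by simp
  qed
qed

lemma cauchy_diff:
  assumes "\<sigma> \<in> cauchy_seqs" "\<tau> \<in> cauchy_seqs"
  shows "(\<lambda>n. \<sigma> n - \<tau> n) \<in> cauchy_seqs"
  unfolding cauchy_seqs_def
proof (intro CollectI conjI allI impI)
  show "range (\<lambda>n. \<sigma> n - \<tau> n) \<subseteq> V"
    using assms by (auto intro: diff_in cauchy_seqs_in)
  fix e :: real assume e: "e > 0"
  obtain M where M: "\<And>m n. m \<ge> M \<Longrightarrow> n \<ge> M \<Longrightarrow> p (\<sigma> m - \<sigma> n) < e / 2"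
    using cauchy_seqsD[OF assms(1), of "e / 2"] e by (metis divide_pos_pos zero_less_numeral)
  obtain L where L: "\<And>m n. m \<ge> L \<Longrightarrow> n \<ge> L \<Longrightarrow> p (\<tau> m - \<tau> n) < e / 2"
    using cauchy_seqsD[OF assms(2), of "e / 2"] e by (metis divide_pos_pos zero_less_numeral)
  show "\<exists>M. \<forall>m\<ge>M. \<forall>n\<ge>M. p (\<sigma> m - \<tau> m - (\<sigma> n - \<tau> n)) < e"
  proof (intro exI[of _ "max M L"] allI impI)
    fix m n assume mn: "max M L \<le> m" "max M L \<le> n"
    have "p (\<sigma> m - \<tau> m - (\<sigma> n - \<tau> n)) = p ((\<sigma> m - \<sigma> n) + (\<tau> n - \<tau> m))"
      by (simp add: algebra_simps)
    also have "\<dots> \<le> p (\<sigma> m - \<sigma> n) + p (\<tau> n - \<tau> m)"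
      using assms by (intro p_triangle diff_in cauchy_seqs_in)
    also have "\<dots> < e" using M[of m n] L[of n m] mn by auto
    finally show "p (\<sigma> m - \<tau> m - (\<sigma> n - \<tau> n)) < e" .
  qed
qed

lemma cauchy_p_convergent:
  assumes "\<sigma> \<in> cauchy_seqs"
  shows "convergent (\<lambda>n. p (\<sigma> n))"
proof -
  have "\<bar>p (\<sigma> m) - p (\<sigma> n)\<bar> \<le> p (\<sigma> m - \<sigma> n)" for m n
    using assms by (intro p_reverse_triangle cauchy_seqs_in)
  then have "Cauchy (\<lambda>n. p (\<sigma> n))"
    using cauchy_seqsD[OF assms] unfolding Cauchy_def dist_real_def
    by (meson order.strict_trans1)
  then show ?thesis by (simp add: Cauchy_convergent_iff)
qed

lemma cnorm_cls:
  assumes "\<sigma> \<in> cauchy_seqs"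
  shows "(\<lambda>n. p (\<sigma> n)) \<longlonglongrightarrow> cnorm (cls \<sigma>)"
proof -
  note r = rep_cls[OF assms]
  have lim: "(\<lambda>n. p (rep (cls \<sigma>) n)) \<longlonglongrightarrow> cnorm (cls \<sigma>)"
    using cauchy_p_convergent[OF r(1)] unfolding cnorm_def by (simp add: convergent_LIMSEQ_iff)
  have "\<bar>p (\<sigma> n) - p (rep (cls \<sigma>) n)\<bar> \<le> p (\<sigma> n - rep (cls \<sigma>) n)" for n
    using assms r(1) by (intro p_reverse_triangle cauchy_seqs_in)
  then have "(\<lambda>n. p (\<sigma> n) - p (rep (cls \<sigma>) n)) \<longlonglongrightarrow> 0"
    by (intro Lim_null_comparison[OF _ r(2)]) auto
  from tendsto_add[OF this lim] show ?thesis by simp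
qed

text \<open>\<open>cdist\<close> subtracts the chosen representatives. Changing them alters the
  difference by a null sequence only, so its class can be computed from \<open>\<sigma>\<close> and
  \<open>\<tau>\<close>.\<close>

lemma cdist_cls:
  assumes \<sigma>: "\<sigma> \<in> cauchy_seqs" and \<tau>: "\<tau> \<in> cauchy_seqs"
  shows "(\<lambda>n. p (\<sigma> n - \<tau> n)) \<longlonglongrightarrow> cdist (cls \<sigma>) (cls \<tau>)"
proof -
  note r = rep_cls[OF \<sigma>] and s = rep_cls[OF \<tau>]
  have "p (\<sigma> n - \<tau> n - (rep (cls \<sigma>) n - rep (cls \<tau>) n))
      \<le> p (\<sigma> n - rep (cls \<sigma>) n) + p (\<tau> n - rep (cls \<tau>) n)" for n
  proof -
    have in_V: "\<sigma> n \<in> V" "\<tau> n \<in> V" "rep (cls \<sigma>) n \<in> V" "rep (cls \<tau>) n \<in> V"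
      using \<sigma> \<tau> r(1) s(1) by (auto intro: cauchy_seqs_in)
    have eq: "\<sigma> n - \<tau> n - (rep (cls \<sigma>) n - rep (cls \<tau>) n)
        = (\<sigma> n - rep (cls \<sigma>) n) + (rep (cls \<tau>) n - \<tau> n)" by simp
    show ?thesis
      unfolding eq using p_triangle[of "\<sigma> n - rep (cls \<sigma>) n" "rep (cls \<tau>) n - \<tau> n"] in_V diff_in
        p_diff_commute[of "\<tau> n" "rep (cls \<tau>) n"] by auto
  qed
  then have "(\<lambda>n. p (\<sigma> n - \<tau> n - (rep (cls \<sigma>) n - rep (cls \<tau>) n))) \<longlonglongrightarrow> 0"
    using \<sigma> \<tau> r(1) s(1)
    by (intro tendsto_sandwich[OF _ _ tendsto_const tendsto_add_zero[OF r(2) s(2)]])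
      (simp_all add: p_nonneg diff_in cauchy_seqs_in)
  then have "cls (\<lambda>n. \<sigma> n - \<tau> n) = cls (\<lambda>n. rep (cls \<sigma>) n - rep (cls \<tau>) n)"
    by (intro cls_eqI cauchy_diff \<sigma> \<tau> r s)
  then show ?thesis
    unfolding cdist_def using cnorm_cls[OF cauchy_diff[OF \<sigma> \<tau>]] by simp
qed

lemma cdist_embed: "v \<in> V \<Longrightarrow> w \<in> V \<Longrightarrow> cdist (embed v) (embed w) = p (v - w)"
  using cdist_cls[OF const_cauchy const_cauchy, of v w]
  by (auto simp: embed_def LIMSEQ_const_iff)

lemma embed_in_points: "v \<in> V \<Longrightarrow> embed v \<in> points"
  by (simp add: embed_def cls_in_points const_cauchy)

lemma cdist_embed_cls:
  "v \<in> V \<Longrightarrow> \<sigma> \<in> cauchy_seqs \<Longrightarrow> (\<lambda>n. p (v - \<sigma> n)) \<longlonglongrightarrow> cdist (embed v) (cls \<sigma>)"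
  using cdist_cls[OF const_cauchy] by (simp add: embed_def)

text \<open>Turns the Cauchy property into convergence to the class; for the Riemann sums this
  becomes the convergence of the simple integrals.\<close>

lemma cdist_embed_cls_tendsto:
  assumes \<sigma>: "\<sigma> \<in> cauchy_seqs"
  shows "(\<lambda>m. cdist (embed (\<sigma> m)) (cls \<sigma>)) \<longlonglongrightarrow> 0"
proof (rule LIMSEQ_I)
  fix e :: real assume e: "e > 0"
  obtain M where M: "\<And>m n. m \<ge> M \<Longrightarrow> n \<ge> M \<Longrightarrow> p (\<sigma> m - \<sigma> n) < e / 2"
    using cauchy_seqsD[OF \<sigma>, of "e / 2"] e by (metis divide_pos_pos zero_less_numeral)
  have "norm (cdist (embed (\<sigma> m)) (cls \<sigma>) - 0) < e" if m: "m \<ge> M" for m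
  proof -
    have lim: "(\<lambda>n. p (\<sigma> m - \<sigma> n)) \<longlonglongrightarrow> cdist (embed (\<sigma> m)) (cls \<sigma>)"
      by (intro cdist_embed_cls cauchy_seqs_in \<sigma>)
    have "cdist (embed (\<sigma> m)) (cls \<sigma>) \<le> e / 2"
      by (rule LIMSEQ_le_const2[OF lim]) (use M m less_imp_le in blast)
    moreover have "cdist (embed (\<sigma> m)) (cls \<sigma>) \<ge> 0"
      by (rule LIMSEQ_le_const[OF lim]) (use \<sigma> in \<open>auto intro: p_nonneg diff_in cauchy_seqs_in\<close>)
    ultimately show ?thesis using e by simp
  qed
  then show "\<exists>M. \<forall>m\<ge>M. norm (cdist (embed (\<sigma> m)) (cls \<sigma>) - 0) < e" by blast
qed

text \<open>The representative chosen for \<open>embed (w i)\<close> may be a nonconstant sequence.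
  A combination of such representatives still differs from the constant sequence by a null sequence,
  hence has the same class.\<close>

lemma lincomb_embed:
  assumes w: "\<And>i. i \<in> I \<Longrightarrow> w i \<in> V"
  shows "lincomb I c (\<lambda>i. embed (w i)) = embed (\<Sum>i\<in>I. sc (c i) (w i))"
proof -
  define r where "r i = rep (embed (w i))" for i
  have r: "r i \<in> cauchy_seqs" "(\<lambda>n. p (w i - r i n)) \<longlonglongrightarrow> 0" if "i \<in> I" for i
    using rep_cls[OF const_cauchy[OF w[OF that]]] by (auto simp: r_def embed_def)
  have in_V: "r i n \<in> V" if "i \<in> I" for i n using cauchy_seqs_in[OF r(1)[OF that]] .
  let ?v = "\<Sum>i\<in>I. sc (c i) (w i)" and ?\<tau> = "\<lambda>n. \<Sum>i\<in>I. sc (c i) (r i n)"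
  have v: "?v \<in> V" and \<tau>: "?\<tau> n \<in> V" for n
    by (auto intro!: sum_in scale_in w in_V)
  have bound: "p (?v - ?\<tau> n) \<le> (\<Sum>i\<in>I. norm (c i) * p (w i - r i n))" for n
  proof -
    have "?v - ?\<tau> n = (\<Sum>i\<in>I. sc (c i) (w i - r i n))"
      by (simp add: sum_subtractf sc.scale_right_diff_distrib)
    also have "p \<dots> \<le> (\<Sum>i\<in>I. p (sc (c i) (w i - r i n)))"
      by (intro p_sum_le scale_in diff_in w in_V)
    also have "\<dots> \<le> (\<Sum>i\<in>I. norm (c i) * p (w i - r i n))"
      by (intro sum_mono p_scale_le diff_in w in_V)
    finally show ?thesis .
  qed
  have "(\<lambda>n. \<Sum>i\<in>I. norm (c i) * p (w i - r i n)) \<longlonglongrightarrow> 0"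
    using r(2) by (intro tendsto_null_sum tendsto_mult_right_zero)
  then have lim: "(\<lambda>n. p (?v - ?\<tau> n)) \<longlonglongrightarrow> 0"
    by (rule tendsto_sandwich[OF _ _ tendsto_const, rotated 2])
      (use bound v \<tau> in \<open>auto intro!: always_eventually p_nonneg diff_in\<close>)
  have "cls (\<lambda>_. ?v) = cls ?\<tau>"
    by (rule cls_eqI[OF const_cauchy[OF v] cauchyI_null_diff[OF const_cauchy[OF v] \<tau> lim] lim])
  then show ?thesis by (simp add: lincomb_def embed_def r_def)
qed

end

subsection \<open>The projective norm\<close>

locale normed_projective_tensor = projective_tensor scX NX scY NY
  for scX :: "'k::real_normed_field \<Rightarrow> 'a::ab_group_add \<Rightarrow> 'a" and NX :: "'a \<Rightarrow> real"
    and scY :: "'k \<Rightarrow> 'b::ab_group_add \<Rightarrow> 'b" and NY :: "'b \<Rightarrow> real" +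
  assumes vsX: "vector_space scX" and vsY: "vector_space scY"
    and normX: "is_norm scX NX" and normY: "is_norm scY NY"
begin

lemma NX_nonneg: "NX x \<ge> 0" and NX_scale: "NX (scX c x) = norm c * NX x"
  using normX by (auto simp: is_norm_def)

lemma NY_nonneg: "NY y \<ge> 0"
  using normY by (auto simp: is_norm_def)

lemma bilinear_formsD:
  assumes "B \<in> bilinear_forms"
  shows "B (x + x') y = B x y + B x' y" "B x (y + y') = B x y + B x y'"
    "B (scX c x) y = c * B x y" "B x (scY c y) = c * B x y"
  using assms by (auto simp: bilinear_forms_def Vector_Spaces.linear_iff)

lemma tensor_apply: "B \<in> bilinear_forms \<Longrightarrow> tensor x y B = B x y"
  by (simp add: tensor_def)

lemma tensor_add_left: "tensor (x + x') y = tensor x y + tensor x' y"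
  and tensor_add_right: "tensor x (y + y') = tensor x y + tensor x y'"
  and tensor_scale_left: "tensor (scX c x) y = tensor_scale c (tensor x y)"
  by (auto simp: tensor_def tensor_scale_def fun_eq_iff bilinear_formsD)

lemma tensor_diff_left: "tensor (x - x') y = tensor x y - tensor x' y"
  using tensor_add_left[of "x - x'" x' y] by simp

lemma tensor_diff_right: "tensor x (y - y') = tensor x y - tensor x y'"
  using tensor_add_right[of x "y - y'" y'] by simp

lemma vector_space_tensor_scale: "vector_space tensor_scale"
  by unfold_locales (auto simp: tensor_scale_def fun_eq_iff algebra_simps)

interpretation ts: vector_space tensor_scale
  by (rule vector_space_tensor_scale)

lemma sum_apply: "(sum f I :: 'd \<Rightarrow> 'k) B = (\<Sum>i\<in>I. f i B)"
  by (induction I rule: infinite_finite_induct) auto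

definition represents :: "(('a \<Rightarrow> 'b \<Rightarrow> 'k) \<Rightarrow> 'k) \<Rightarrow> nat \<Rightarrow> (nat \<Rightarrow> 'a) \<Rightarrow> (nat \<Rightarrow> 'b) \<Rightarrow> bool" where
  "represents v n x y \<longleftrightarrow> v = (\<Sum>i<n. tensor (x i) (y i))"

text \<open>Concatenation adds the costs, which is the triangle inequality before infima are
  taken.\<close>

lemma represents_add:
  assumes "represents v n x y" "represents w m x' y'"
  obtains x'' y'' where "represents (v + w) (n + m) x'' y''"
    "(\<Sum>i<n + m. NX (x'' i) * NY (y'' i)) = (\<Sum>i<n. NX (x i) * NY (y i)) + (\<Sum>i<m. NX (x' i) * NY (y' i))"
proof -
  have split: "(\<Sum>i<n + m. f i) = (\<Sum>i<n. f i) + (\<Sum>i<m. f (n + i))"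
    for f :: "nat \<Rightarrow> 'x::comm_monoid_add"
    using sum.atLeastLessThan_concat[of 0 n "n + m" f] sum.shift_bounds_nat_ivl[of f 0 n m]
    by (simp add: lessThan_atLeast0 add.commute)
  let ?x = "\<lambda>i. if i < n then x i else x' (i - n)" and ?y = "\<lambda>i. if i < n then y i else y' (i - n)"
  show ?thesis
    by (rule that[of ?x ?y]) (use assms in \<open>simp_all add: represents_def split\<close>)
qed

lemma represents_scale:
  "represents v n x y \<Longrightarrow> represents (tensor_scale c v) n (\<lambda>i. scX c (x i)) y"
  by (simp add: represents_def tensor_scale_left ts.scale_sum_right)

lemma tensor_in: "tensor x y \<in> alg_tensor"
  unfolding alg_tensor_def by (rule ts.span_base) auto

lemma represents_exists:
  assumes "v \<in> alg_tensor"
  shows "\<exists>n x y. represents v n x y"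
  using assms unfolding alg_tensor_def
proof (induction rule: ts.span_induct_alt)
  case base
  show ?case by (rule exI[of _ "0::nat"]) (simp add: represents_def zero_fun_def)
next
  case (step c w v)
  then obtain a b n x y where "w = tensor a b" and v: "represents v n x y" by auto
  then have "represents (tensor_scale c w) 1 (\<lambda>_. scX c a) (\<lambda>_. b)"
    by (simp add: represents_def tensor_scale_left)
  then show ?case using v by (metis represents_add)
qed

lemma proj_norm_le:
  assumes "represents v n x y"
  shows "proj_norm v \<le> (\<Sum>i<n. NX (x i) * NY (y i))"
  unfolding proj_norm_def
proof (rule cInf_lower)
  show "bdd_below {\<Sum>i<n. NX (x i) * NY (y i) |n x y. v = (\<Sum>i<n. tensor (x i) (y i))}"
    by (rule bdd_belowI[of _ 0]) (auto intro!: sum_nonneg mult_nonneg_nonneg NX_nonneg NY_nonneg)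
qed (use assms in \<open>auto simp: represents_def\<close>)

lemma proj_norm_ge:
  assumes "v \<in> alg_tensor"
    and "\<And>n x y. represents v n x y \<Longrightarrow> c \<le> (\<Sum>i<n. NX (x i) * NY (y i))"
  shows "c \<le> proj_norm v"
  unfolding proj_norm_def
  by (rule cInf_greatest) (use represents_exists[OF assms(1)] assms(2) in \<open>auto simp: represents_def\<close>)

lemma proj_norm_tensor_le: "proj_norm (tensor x y) \<le> NX x * NY y"
  using proj_norm_le[of "tensor x y" 1 "\<lambda>_. x" "\<lambda>_. y"] by (simp add: represents_def)

lemma proj_norm_triangle:
  assumes v: "v \<in> alg_tensor" and w: "w \<in> alg_tensor"
  shows "proj_norm (v + w) \<le> proj_norm v + proj_norm w"
proof -
  have "proj_norm (v + w) \<le> (\<Sum>i<n. NX (x i) * NY (y i)) + (\<Sum>i<m. NX (x' i) * NY (y' i))"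
    if "represents v n x y" "represents w m x' y'" for n x y m x' y'
    using represents_add[OF that] proj_norm_le by metis
  then have "proj_norm (v + w) - (\<Sum>i<m. NX (x' i) * NY (y' i)) \<le> proj_norm v"
    if "represents w m x' y'" for m x' y'
    using that by (intro proj_norm_ge[OF v]) (auto simp: algebra_simps)
  then have "proj_norm (v + w) - proj_norm v \<le> proj_norm w"
    by (intro proj_norm_ge[OF w]) (auto simp: algebra_simps)
  then show ?thesis by simp
qed

lemma proj_norm_scale_le:
  assumes "v \<in> alg_tensor"
  shows "proj_norm (tensor_scale c v) \<le> norm c * proj_norm v"
proof (cases "c = 0")
  case True
  have "proj_norm (0 :: ('a \<Rightarrow> 'b \<Rightarrow> 'k) \<Rightarrow> 'k) \<le> 0"
    using proj_norm_le[of 0 0 undefined undefined] by (simp add: represents_def)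
  then show ?thesis using True by simp
next
  case False
  have "proj_norm (tensor_scale c v) / norm c \<le> proj_norm v"
  proof (rule proj_norm_ge[OF assms])
    fix n x y assume "represents v n x y"
    then have "proj_norm (tensor_scale c v) \<le> norm c * (\<Sum>i<n. NX (x i) * NY (y i))"
      using proj_norm_le[OF represents_scale] by (fastforce simp: NX_scale sum_distrib_left mult.assoc)
    then show "proj_norm (tensor_scale c v) / norm c \<le> (\<Sum>i<n. NX (x i) * NY (y i))"
      using False by (simp add: field_simps)
  qed
  then show ?thesis using False by (simp add: field_simps)
qed

sublocale hat: seminorm_completion alg_tensor tensor_scale proj_norm
  by unfold_locales
    (auto simp: proj_norm_triangle proj_norm_scale_le alg_tensor_def ts.span_zero ts.span_add ts.span_scale
      vector_space_tensor_scale[unfolded vector_space_def]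
      intro: proj_norm_triangle[unfolded alg_tensor_def] proj_norm_scale_le[unfolded alg_tensor_def])

text \<open>The easy half of the duality between bounded bilinear forms and the projective norm. It
  supplies the lower bound on the norm of the Riemann sums and the continuity of every test applied
  to a series.\<close>

lemma norm_apply_le:
  assumes B: "B \<in> bilinear_forms" and bound: "\<And>x y. norm (B x y) \<le> K * (NX x * NY y)" and K: "K \<ge> 0"
    and v: "v \<in> alg_tensor"
  shows "norm (v B) \<le> K * proj_norm v"
proof -
  have le: "norm (v B) \<le> K * (\<Sum>i<n. NX (x i) * NY (y i))" if "represents v n x y" for n x y
  proof -
    have "norm (v B) = norm (\<Sum>i<n. B (x i) (y i))"
      using that B by (simp add: represents_def sum_apply tensor_apply)
    also have "\<dots> \<le> (\<Sum>i<n. K * (NX (x i) * NY (y i)))"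
      by (rule sum_norm_le) (rule bound)
    finally show ?thesis by (simp add: sum_distrib_left)
  qed
  show ?thesis
  \<comment> \<open>Division by \<open>K\<close> is impossible here, but any single representation
    already shows that \<open>v B\<close> vanishes.\<close>
  proof (cases "K = 0")
    case True
    then show ?thesis using represents_exists[OF v] le by fastforce
  next
    case False
    then have "norm (v B) / K \<le> proj_norm v"
      using le K by (intro proj_norm_ge[OF v]) (simp add: field_simps)
    then show ?thesis using False K by (simp add: field_simps)
  qed
qed

end

subsection \<open>The moment curve and the new norm\<close>

text \<open>One setting for both fields: \<open>inner a 1\<close> is the real part of a real or
  complex scalar \<open>a\<close>, which is what \<open>real_inner\<close> is for.\<close>

locale scalar_banach =
  fixes sc :: "'k::{real_normed_field,real_inner} \<Rightarrow> 'a::banach \<Rightarrow> 'a"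
  assumes vector_space_sc: "vector_space sc"
    and sc_of_real: "sc (of_real r) x = r *\<^sub>R x"
begin

interpretation sc: vector_space sc
  by (rule vector_space_sc)

section \<open>Bounded scalar-linear functionals\<close>

definition dual :: "('a \<Rightarrow> 'k) set" where
  "dual = {f. (\<forall>x y. f (x + y) = f x + f y) \<and> (\<forall>c x. f (sc c x) = c * f x) \<and>
              (\<exists>C. \<forall>z. norm (f z) \<le> C * norm z)}"

lemma dualI:
  assumes "\<And>x y. f (x + y) = f x + f y" "\<And>c x. f (sc c x) = c * f x"
    "\<And>z. norm (f z) \<le> C * norm z"
  shows "f \<in> dual"
  using assms by (auto simp: dual_def)

lemma dual_add: "f \<in> dual \<Longrightarrow> f (x + y) = f x + f y"
  and dual_scale: "f \<in> dual \<Longrightarrow> f (sc c x) = c * f x"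
  by (auto simp: dual_def)

lemma dual_bounded_linear: assumes "f \<in> dual" shows "bounded_linear f"
proof -
  obtain C where "\<And>z. norm (f z) \<le> C * norm z" using assms by (auto simp: dual_def)
  moreover have "f (r *\<^sub>R x) = r *\<^sub>R f x" for r x
    using dual_scale[OF assms, of "of_real r" x] by (simp add: sc_of_real scaleR_conv_of_real)
  ultimately show ?thesis
    by (intro bounded_linear_intro[where K = C]) (auto simp: dual_add[OF assms] mult.commute)
qed

lemma dual_diff: "f \<in> dual \<Longrightarrow> f (x - y) = f x - f y"
  and dual_sum: "f \<in> dual \<Longrightarrow> f (sum h I) = (\<Sum>i\<in>I. f (h i))"
  using dual_bounded_linear[THEN bounded_linear.linear]
  by (auto simp: linear_diff linear_sum)

lemma zero_in_dual: "(\<lambda>_. 0) \<in> dual"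
  by (rule dualI[where C = 0]) auto

lemma add_in_dual:
  assumes f: "f \<in> dual" and h: "h \<in> dual"
  shows "(\<lambda>x. f x + h x) \<in> dual"
proof -
  obtain C D where "\<And>z. norm (f z) \<le> C * norm z" "\<And>z. norm (h z) \<le> D * norm z"
    using f h by (auto simp: dual_def)
  then have "norm (f z + h z) \<le> (C + D) * norm z" for z
    unfolding distrib_right by (intro norm_triangle_le add_mono)
  then show ?thesis
    by (rule dualI[rotated 2]) (simp_all add: dual_add f h dual_scale algebra_simps)
qed

lemma scale_in_dual:
  assumes f: "f \<in> dual"
  shows "(\<lambda>x. c * f x) \<in> dual"
proof -
  obtain C where "\<And>z. norm (f z) \<le> C * norm z" using f by (auto simp: dual_def)
  then have "norm (c * f z) \<le> (norm c * C) * norm z" for z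
    by (simp add: norm_mult mult.assoc mult_left_mono)
  then show ?thesis
    by (rule dualI[rotated 2]) (simp_all add: dual_add f dual_scale algebra_simps)
qed

lemma diff_in_dual: "f \<in> dual \<Longrightarrow> h \<in> dual \<Longrightarrow> (\<lambda>x. f x - h x) \<in> dual"
  using add_in_dual[of f "\<lambda>x. - 1 * h x"] scale_in_dual[of h "- 1"] by simp

lemma sum_in_dual: "(\<And>i. i \<in> I \<Longrightarrow> f i \<in> dual) \<Longrightarrow> (\<lambda>x. \<Sum>i\<in>I. f i x) \<in> dual"
  by (induction I rule: infinite_finite_induct) (auto intro: zero_in_dual add_in_dual)

section \<open>Biorthogonal systems\<close>

lemma biorthogonal_step:
  fixes e :: "nat \<Rightarrow> 'a" and g :: "nat \<Rightarrow> 'a \<Rightarrow> 'k"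
  assumes inf: "infinite_dim sc" and separating: "\<And>x. x \<noteq> 0 \<Longrightarrow> \<exists>f\<in>dual. f x \<noteq> 0"
    and g: "\<And>i. i < n \<Longrightarrow> g i \<in> dual"
    and biorth: "\<And>i j. i < n \<Longrightarrow> j < n \<Longrightarrow> g i (e j) = (if i = j then 1 else 0)"
    and b: "b > 0"
  obtains x f where "f \<in> dual" "f x = 1" "norm x \<le> b"
    "\<And>i. i < n \<Longrightarrow> f (e i) = 0" "\<And>i. i < n \<Longrightarrow> g i x = 0"
proof -
  have "\<exists>x. x \<notin> sc.span (e ` {..<n})"
    using inf unfolding infinite_dim_def by blast
  then obtain w where w: "w \<notin> sc.span (e ` {..<n})" by blast
  \<comment> \<open>Removing the coordinates of \<open>w\<close> makes the new vector invisible to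
    the old functionals; it is nonzero because \<open>w\<close> lies outside the span.\<close>
  define z where "z = w - (\<Sum>i<n. sc (g i w) (e i))"
  have "(\<Sum>i<n. sc (g i w) (e i)) \<in> sc.span (e ` {..<n})"
    by (intro sc.span_sum sc.span_scale sc.span_base) auto
  then have "z \<noteq> 0" using w by (auto simp: z_def)
  have gz: "g i z = 0" if "i < n" for i
  proof -
    have "g i z = g i w - (\<Sum>j<n. g j w * (if i = j then 1 else 0))"
      using g[OF that] biorth that by (simp add: z_def dual_diff dual_sum dual_scale)
    then show ?thesis using that by (simp add: mult_delta_right)
  qed
  obtain f0 where f0: "f0 \<in> dual" "f0 z \<noteq> 0" using separating \<open>z \<noteq> 0\<close> by blast
  \<comment> \<open>The dual correction: \<open>f1\<close> kills the old vectors, and its value at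
    \<open>z\<close> is unchanged because every \<open>g i\<close> vanishes there.\<close>
  define f1 where "f1 x = f0 x - (\<Sum>i<n. f0 (e i) * g i x)" for x
  have f1: "f1 \<in> dual"
    unfolding f1_def using g f0 by (intro diff_in_dual sum_in_dual scale_in_dual) auto
  have f1z: "f1 z = f0 z" by (simp add: f1_def gz)
  have f1e: "f1 (e j) = 0" if "j < n" for j
  proof -
    have "f1 (e j) = f0 (e j) - (\<Sum>i<n. f0 (e i) * (if i = j then 1 else 0))"
      using biorth that by (simp add: f1_def)
    then show ?thesis using that by (simp add: mult_delta_right)
  qed
  \<comment> \<open>The vector can be made as short as desired because the functional is rescaled to
    compensate.\<close>
  define r where "r = b / norm z"
  have "r > 0" using b \<open>z \<noteq> 0\<close> by (simp add: r_def)
  define x where "x = r *\<^sub>R z"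
  have "f1 x = of_real r * f1 z"
    using dual_scale[OF f1, of "of_real r" z] by (simp add: x_def sc_of_real)
  then have f1x: "f1 x \<noteq> 0" using f1z f0 \<open>r > 0\<close> by simp
  show ?thesis
  proof (rule that[of "\<lambda>y. inverse (f1 x) * f1 y" x])
    show "(\<lambda>y. inverse (f1 x) * f1 y) \<in> dual" by (rule scale_in_dual[OF f1])
    show "norm x \<le> b" using b \<open>z \<noteq> 0\<close> by (simp add: x_def r_def)
    show "g i x = 0" if "i < n" for i
      using dual_scale[OF g[OF that], of "of_real r" z] gz[OF that] by (simp add: x_def sc_of_real)
  qed (use f1x f1e in auto)
qed

lemma biorthogonal_system_exists:
  assumes inf: "infinite_dim sc" and separating: "\<And>x. x \<noteq> 0 \<Longrightarrow> \<exists>f\<in>dual. f x \<noteq> 0"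
    and b: "\<And>n. b n > 0"
  obtains e :: "nat \<Rightarrow> 'a" and g :: "nat \<Rightarrow> 'a \<Rightarrow> 'k"
  where "\<And>n. g n \<in> dual" "\<And>n. norm (e n) \<le> b n" "\<And>i j. g i (e j) = (if i = j then 1 else 0)"
proof -
  define P :: "(nat \<Rightarrow> 'a \<times> ('a \<Rightarrow> 'k)) \<Rightarrow> nat \<Rightarrow> 'a \<times> ('a \<Rightarrow> 'k) \<Rightarrow> bool" where
    "P h n q \<longleftrightarrow> snd q \<in> dual \<and> snd q (fst q) = 1 \<and> norm (fst q) \<le> b n \<and>
       (\<forall>i<n. snd q (fst (h i)) = 0 \<and> snd (h i) (fst q) = 0)" for h n q
  have "\<exists>h. \<forall>n. P h n (h n)"
  \<comment> \<open>Vector and functional are chosen together, each new pair being orthogonal to the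
    earlier ones on both sides; for distinct indices the biorthogonality relation comes from the
    later one.\<close>
  proof (rule dependent_wellorder_choice)
    fix n :: nat and h assume IH: "\<And>i. i < n \<Longrightarrow> P h i (h i)"
    have biorth: "snd (h i) (fst (h j)) = (if i = j then 1 else 0)" if "i < n" "j < n" for i j
      using IH[OF that(1)] IH[OF that(2)] by (cases i j rule: linorder_cases) (auto simp: P_def)
    have g: "snd (h i) \<in> dual" if "i < n" for i
      using IH[OF that] by (simp add: P_def)
    show "\<exists>q. P h n q"
    proof (rule biorthogonal_step[OF inf separating g biorth b])
      fix f x assume "f \<in> dual" "f x = 1" "norm x \<le> b n"
        "\<And>i. i < n \<Longrightarrow> f (fst (h i)) = 0" "\<And>i. i < n \<Longrightarrow> snd (h i) x = 0"
      then show ?thesis by (intro exI[of _ "(x, f)"]) (simp add: P_def)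
    qed
  qed (auto simp: P_def)
  then obtain h where h: "\<And>n. P h n (h n)" by blast
  have "snd (h i) (fst (h j)) = (if i = j then 1 else 0)" for i j
    using h[of i] h[of j] by (cases i j rule: linorder_cases) (auto simp: P_def)
  then show ?thesis
    using that[of "\<lambda>n. snd (h n)" "\<lambda>n. fst (h n)"] h by (auto simp: P_def)
qed

end

text \<open>In \<open>e_small\<close> the geometric factor makes the curve converge, and the factor
  \<open>1 / (n + 1)\<close> absorbs the \<open>n\<close> from the Lipschitz bound on
  \<open>t ^ n\<close>. The bound \<open>C\<close> covers \<open>g 0\<close>, \<open>g 1\<close> and
  \<open>g 2\<close>, the functionals from which \<open>A\<close> is built.\<close>

locale moment_curve = scalar_banach sc
  for sc :: "'k::{real_normed_field,real_inner} \<Rightarrow> 'a::banach \<Rightarrow> 'a" +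
  fixes e :: "nat \<Rightarrow> 'a" and g :: "nat \<Rightarrow> 'a \<Rightarrow> 'k" and C :: real
  assumes norm_sc: "norm (sc c x) = norm c * norm x"
    and norming: "\<exists>f\<in>dual. (\<forall>z. norm (f z) \<le> 2 * norm z) \<and> norm (f x) \<ge> norm x"
    and g_dual: "g n \<in> dual"
    and e_small: "norm (e n) \<le> (1/2) ^ n / (n + 1)"
    and biorth: "g i (e j) = (if i = j then 1 else 0)"
    and C_ge: "C \<ge> 1"
    and g_bound: "i \<le> 2 \<Longrightarrow> norm (g i z) \<le> C * norm z"
begin

interpretation sc: vector_space sc
  by (rule vector_space_sc)

definition curve :: "real \<Rightarrow> 'a" where
  "curve t = (\<Sum>n. t ^ n *\<^sub>R e n)"

lemma e_small': "norm (e n) \<le> (1/2) ^ n" "real n * norm (e n) \<le> (1/2) ^ n"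
proof -
  have "(real n + 1) * norm (e n) \<le> (real n + 1) * ((1/2) ^ n / (real n + 1))"
    by (intro mult_left_mono e_small) simp
  also have "\<dots> = (1/2) ^ n" by simp
  finally show "norm (e n) \<le> (1/2) ^ n" "real n * norm (e n) \<le> (1/2) ^ n"
    using mult_nonneg_nonneg[of "real n" "norm (e n)"] norm_ge_zero[of "e n"]
    unfolding distrib_right by linarith+
qed

lemma summable_curve:
  assumes "t \<in> {0..1}"
  shows "summable (\<lambda>n. norm (t ^ n *\<^sub>R e n))" "summable (\<lambda>n. t ^ n *\<^sub>R e n)"
proof -
  have le: "norm (t ^ n *\<^sub>R e n) \<le> (1/2) ^ n" for n
    using assms e_small'(1)[of n] mult_mono[of "t ^ n" 1 "norm (e n)" "(1/2) ^ n"]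
    by (simp add: power_le_one)
  have "summable (\<lambda>n. (1/2::real) ^ n)" by (rule summable_geometric) simp
  then show "summable (\<lambda>n. norm (t ^ n *\<^sub>R e n))"
    by (rule summable_comparison_test'[where N = 0]) (simp only: real_norm_def abs_norm_cancel le)
  then show "summable (\<lambda>n. t ^ n *\<^sub>R e n)" by (rule summable_norm_cancel)
qed

lemma g_curve:
  assumes "t \<in> {0..1}"
  shows "g i (curve t) = of_real (t ^ i)"
proof -
  have scale: "g i (t ^ n *\<^sub>R e n) = (if n = i then of_real (t ^ i) else 0)" for n
    using dual_scale[OF g_dual, of i "of_real (t ^ n)" "e n"] biorth[of i n] by (simp add: sc_of_real del: of_real_power)
  have "g i (curve t) = (\<Sum>n. g i (t ^ n *\<^sub>R e n))"
    unfolding curve_def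
    by (rule bounded_linear.suminf[OF dual_bounded_linear[OF g_dual] summable_curve(2)[OF assms]])
  also have "\<dots> = of_real (t ^ i)"
    unfolding scale by (rule sums_unique[OF sums_single, symmetric])
  finally show ?thesis .
qed

lemma curve_lipschitz:
  assumes "s \<in> {0..1}" "t \<in> {0..1}"
  shows "norm (curve s - curve t) \<le> 2 * \<bar>s - t\<bar>"
proof -
  have le: "norm (s ^ n *\<^sub>R e n - t ^ n *\<^sub>R e n) \<le> \<bar>s - t\<bar> * (1/2) ^ n" for n
  proof -
    have "norm (s ^ n *\<^sub>R e n - t ^ n *\<^sub>R e n) = \<bar>s ^ n - t ^ n\<bar> * norm (e n)"
      by (simp flip: scaleR_diff_left)
    also have "\<dots> \<le> (real n * \<bar>s - t\<bar>) * norm (e n)"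
      using norm_power_diff[of s t n] assms by (intro mult_right_mono) auto
    also have "\<dots> \<le> \<bar>s - t\<bar> * (1/2) ^ n"
      using mult_left_mono[OF e_small'(2)[of n], of "\<bar>s - t\<bar>"] by (simp add: mult_ac)
    finally show ?thesis .
  qed
  have summ: "summable (\<lambda>n. \<bar>s - t\<bar> * (1/2) ^ n)"
    by (intro summable_mult summable_geometric) simp
  have "curve s - curve t = (\<Sum>n. s ^ n *\<^sub>R e n - t ^ n *\<^sub>R e n)"
    unfolding curve_def using assms by (intro suminf_diff summable_curve)
  also have "norm \<dots> \<le> (\<Sum>n. \<bar>s - t\<bar> * (1/2) ^ n)"
    by (rule norm_suminf_le[OF le summ])
  also have "\<dots> = 2 * \<bar>s - t\<bar>"
    using suminf_geometric[of "1/2::real"] by (simp add: suminf_mult summable_geometric)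
  finally show ?thesis .
qed

lemma norm_curve_le: assumes "t \<in> {0..1}" shows "norm (curve t) \<le> 3"
proof -
  \<comment> \<open>Since \<open>0 ^ 0 = 1\<close>, the term of index zero survives.\<close>
  have "curve 0 = e 0"
    unfolding curve_def by (subst suminf_finite[of "{0}"]) auto
  then show ?thesis
    using curve_lipschitz[OF assms, of 0] e_small'(1)[of 0] norm_triangle_ineq4[of "curve t - curve 0" "- curve 0"] assms
    by auto
qed

text \<open>Each \<open>A (curve s)\<close> is bounded by \<open>5 * C\<close> in the old norm,
  because the coefficients of \<open>A\<close> have total modulus five. With twice that value,
  \<open>A (curve s)\<close> is at most 1/2 on the ball of radius \<open>1 / D\<close>, safely below
  the value 1 reached on the curve.\<close>

abbreviation D :: real where "D \<equiv> 10 * C"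

definition norming_set :: "('a \<Rightarrow> 'k) set" where
  "norming_set = {\<phi>\<in>dual. (\<forall>t\<in>{0..1}. norm (\<phi> (curve t)) \<le> 1) \<and> (\<forall>z. norm (\<phi> z) \<le> D * norm z)}"

text \<open>
  By the bipolar theorem the unit ball of \<open>N\<close> is the closed absolutely convex hull of the curve
  and the ball of radius \<open>1/D\<close>. Defining \<open>N\<close> through the polar avoids manipulating convex combinations.
\<close>

definition N :: "'a \<Rightarrow> real" where
  "N x = (SUP \<phi>\<in>norming_set. norm (\<phi> x))"

lemma norming_set_ne: "norming_set \<noteq> {}"
  using zero_in_dual C_ge by (auto simp: norming_set_def intro!: exI[of _ "\<lambda>_. 0"])

lemma N_upper: "\<phi> \<in> norming_set \<Longrightarrow> norm (\<phi> x) \<le> N x"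
  unfolding N_def
  by (rule cSUP_upper) (auto simp: norming_set_def intro!: bdd_aboveI[of _ "D * norm x"])

lemma N_least: "(\<And>\<phi>. \<phi> \<in> norming_set \<Longrightarrow> norm (\<phi> x) \<le> c) \<Longrightarrow> N x \<le> c"
  unfolding N_def by (rule cSUP_least[OF norming_set_ne])

lemma N_le: "N x \<le> D * norm x"
  by (rule N_least) (auto simp: norming_set_def)

lemma N_curve_le: "t \<in> {0..1} \<Longrightarrow> N (curve t) \<le> 1"
  by (rule N_least) (auto simp: norming_set_def)

lemma N_nonneg: "N x \<ge> 0"
  using norming_set_ne N_upper[of _ x] by (meson ex_in_conv norm_ge_zero order_trans)

text \<open>The working form of the polar description: a bound for a functional has to be tested
  only on the generators of the unit ball, the curve and the ball of radius
  \<open>1 / D\<close>.\<close>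

lemma norm_le_N:
  assumes \<phi>: "\<phi> \<in> dual" and c: "c \<ge> 0"
    and curve: "\<And>t. t \<in> {0..1} \<Longrightarrow> norm (\<phi> (curve t)) \<le> c"
    and ball: "\<And>z. norm (\<phi> z) \<le> c * D * norm z"
  shows "norm (\<phi> x) \<le> c * N x"
proof (cases "c = 0")
  case False
  then have c: "c > 0" using c by simp
  have norm_eq: "norm (of_real (inverse c) * \<phi> x) = norm (\<phi> x) / c" for x
    unfolding norm_mult norm_of_real using c by (simp add: divide_inverse mult.commute)
  have "norm (\<phi> z) / c \<le> D * norm z" for z
    unfolding pos_divide_le_eq[OF c] using ball[of z] by (simp add: mult_ac)
  then have "(\<lambda>x. of_real (inverse c) * \<phi> x) \<in> norming_set"
    unfolding norming_set_def mem_Collect_eq norm_eq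
    using scale_in_dual[OF \<phi>] curve c by auto
  from N_upper[OF this, of x] show ?thesis
    unfolding norm_eq using c by (simp add: pos_divide_le_eq mult.commute)
qed (use ball[of x] in simp)

lemma N_ge: "norm x / 6 \<le> N x"
proof -
  obtain f where f: "f \<in> dual" "\<And>z. norm (f z) \<le> 2 * norm z" "norm (f x) \<ge> norm x"
    using norming[of x] by blast
  \<comment> \<open>Six is the factor 2 of the norming functional times the bound 3 for the norm on
    the curve; on the small ball the factor \<open>D\<close> leaves ample room.\<close>
  have "norm (f x) \<le> 6 * N x"
  proof (rule norm_le_N[OF f(1)])
    fix t :: real assume "t \<in> {0..1}"
    then show "norm (f (curve t)) \<le> 6" using f(2)[of "curve t"] norm_curve_le[of t] by simp
  next
    fix z :: 'a
    have "1 * norm z \<le> C * norm z" by (rule mult_right_mono[OF C_ge]) simp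
    moreover have "6 * D * norm z = 60 * (C * norm z)" by simp
    ultimately show "norm (f z) \<le> 6 * D * norm z"
      using f(2)[of z] norm_ge_zero[of z] by linarith
  qed simp
  then show ?thesis using f(3) by simp
qed

lemma N_scale_le: "N (sc c x) \<le> norm c * N x"
proof (rule N_least)
  fix \<phi> assume \<phi>: "\<phi> \<in> norming_set"
  then have "norm (\<phi> (sc c x)) = norm c * norm (\<phi> x)"
    by (simp add: norming_set_def dual_scale norm_mult)
  then show "norm (\<phi> (sc c x)) \<le> norm c * N x"
    using N_upper[OF \<phi>] by (simp add: mult_left_mono)
qed

lemma is_norm_N: "is_norm sc N"
  unfolding is_norm_def
proof (intro conjI allI)
  fix x y
  show "N x \<ge> 0" by (rule N_nonneg)
  show "N x = 0 \<longleftrightarrow> x = 0"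
    using N_ge[of x] N_le[of x] N_nonneg[of x] by auto
  show "N (x + y) \<le> N x + N y"
  proof (rule N_least)
    fix \<phi> assume \<phi>: "\<phi> \<in> norming_set"
    then have "\<phi> (x + y) = \<phi> x + \<phi> y" by (simp add: norming_set_def dual_add)
    then show "norm (\<phi> (x + y)) \<le> N x + N y"
      using N_upper[OF \<phi>, of x] N_upper[OF \<phi>, of y] by (simp add: norm_triangle_le)
  qed
  fix c
  show "N (sc c x) = norm c * N x"
  proof (cases "c = 0")
    case True
    then show ?thesis using N_scale_le[of c x] N_nonneg[of "sc c x"] by simp
  next
    case False
    then have "N x \<le> inverse (norm c) * N (sc c x)"
      using N_scale_le[of "inverse c" "sc c x"] by (simp add: norm_inverse)
    then have "norm c * N x \<le> N (sc c x)" using False by (simp add: field_simps)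
    then show ?thesis using N_scale_le[of c x] by simp
  qed
qed

lemma equivalent_norms_N: "equivalent_norms norm N"
  unfolding equivalent_norms_def
  using N_ge N_le C_ge by (intro exI[of _ "1/6"] exI[of _ D]) auto

section \<open>The bilinear form and its contact points\<close>

definition A :: "'a \<Rightarrow> 'a \<Rightarrow> 'k" where
  "A x y = g 0 x * g 0 y - g 2 x * g 0 y - g 0 x * g 2 y + 2 * (g 1 x * g 1 y)"

lemma A_commute: "A x y = A y x"
  by (simp add: A_def mult.commute)

lemma A_dual: "A x \<in> dual"
proof -
  have "(\<lambda>y. g 0 x * g 0 y - g 2 x * g 0 y - g 0 x * g 2 y + 2 * g 1 x * g 1 y) \<in> dual"
    by (intro add_in_dual diff_in_dual scale_in_dual g_dual)
  then show ?thesis by (simp add: A_def[abs_def] mult.assoc)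
qed

lemma A_dual': "(\<lambda>x. A x y) \<in> dual"
  using A_dual[of y] by (simp add: A_commute[of _ y])

lemma A_curve:
  assumes "s \<in> {0..1}" "t \<in> {0..1}"
  shows "A (curve s) (curve t) = of_real (1 - (s - t)\<^sup>2)"
  using assms by (simp add: A_def g_curve power2_eq_square algebra_simps)

lemma norm_A_le: "norm (A x y) \<le>
    norm (g 0 x) * norm (g 0 y) + norm (g 2 x) * norm (g 0 y) + norm (g 0 x) * norm (g 2 y)
      + 2 * (norm (g 1 x) * norm (g 1 y))"
  unfolding A_def
  by (intro order_trans[OF norm_triangle_ineq] add_mono order_trans[OF norm_triangle_ineq4])
    (simp_all add: norm_mult)

lemma norm_A_curve_le:
  assumes "s \<in> {0..1}"
  shows "norm (A (curve s) z) \<le> D / 2 * norm z"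
proof -
  have g: "norm (g i (curve s)) \<le> 1" for i
    using assms by (simp add: g_curve norm_power power_le_one)
  have "norm (g i (curve s)) * norm (g j z) \<le> 1 * (C * norm z)" if "j \<le> 2" for i j
    by (intro mult_mono g g_bound that) auto
  from this[of 0 0] this[of 0 2] this[of 2 0] this[of 1 1] show ?thesis
    using norm_A_le[of "curve s" z] by simp
qed

lemma norm_A_le_norm: "norm (A x y) \<le> 5 * C\<^sup>2 * norm x * norm y"
proof -
  have "norm (g i x) * norm (g j y) \<le> (C * norm x) * (C * norm y)" if "i \<le> 2" "j \<le> 2" for i j
    using C_ge by (intro mult_mono g_bound that) auto
  from this[of 0 0] this[of 0 2] this[of 2 0] this[of 1 1] show ?thesis
    using norm_A_le[of x y] by (simp add: power2_eq_square algebra_simps)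
qed

lemma square_le_one: "s \<in> {0..1} \<Longrightarrow> t \<in> {0..1} \<Longrightarrow> (s - t)\<^sup>2 \<le> (1::real)"
  by (subst abs_square_le_1) auto

lemma norm_A_curve_curve_le:
  assumes "s \<in> {0..1}" "t \<in> {0..1}"
  shows "norm (A (curve s) (curve t)) \<le> 1"
  unfolding A_curve[OF assms] norm_of_real using square_le_one[OF assms] by auto

lemma norm_A_curve_le_N:
  assumes s: "s \<in> {0..1}"
  shows "norm (A (curve s) y) \<le> N y"
proof -
  have "A (curve s) \<in> norming_set"
    unfolding norming_set_def
  proof (intro CollectI conjI A_dual ballI allI)
    fix z :: 'a
    have "D / 2 * norm z \<le> D * norm z" using C_ge by (intro mult_right_mono) auto
    then show "norm (A (curve s) z) \<le> D * norm z" using norm_A_curve_le[OF s, of z] by simp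
  qed (use norm_A_curve_curve_le s in blast)
  then show ?thesis by (rule N_upper)
qed

text \<open>An intermediate estimate with the new norm in one argument only. It controls
  \<open>A\<close> on the small ball in the other argument, as \<open>norm_A_le_sup\<close>
  requires.\<close>

lemma norm_A_le_mixed: "norm (A x y) \<le> D / 2 * norm x * N y"
proof (rule norm_le_N[OF A_dual])
  show "0 \<le> D / 2 * norm x" using C_ge by simp
  show "norm (A x (curve t)) \<le> D / 2 * norm x" if "t \<in> {0..1}" for t
    using norm_A_curve_le[OF that, of x] by (simp add: A_commute)
  show "norm (A x z) \<le> D / 2 * norm x * D * norm z" for z
  proof -
    have "5 * C\<^sup>2 * norm x * norm z \<le> 50 * C\<^sup>2 * norm x * norm z"
      by (intro mult_right_mono) auto
    then show ?thesis using norm_A_le_norm[of x z] by (simp add: power2_eq_square mult_ac)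
  qed
qed

text \<open>On the ball of radius \<open>1 / D\<close> the functional \<open>A _ y\<close> is at
  most \<open>N y / 2\<close>, hence at most \<open>r\<close>. The small ball is thus harmless and
  the norm of the functional is decided on the curve.\<close>

lemma norm_A_le_sup:
  assumes "\<And>s. s \<in> {0..1} \<Longrightarrow> norm (A (curve s) y) \<le> r" and "N y \<le> 2 * r"
  shows "norm (A x y) \<le> r * N x"
proof (rule norm_le_N[OF A_dual'])
  show "0 \<le> r" using assms(2) N_nonneg[of y] by simp
  show "norm (A z y) \<le> r * D * norm z" for z
  proof -
    have "D / 2 * norm z * N y \<le> D / 2 * norm z * (2 * r)"
      using assms(2) C_ge by (intro mult_left_mono) auto
    then show ?thesis using norm_A_le_mixed[of z y] by (simp add: mult_ac)
  qed
qed (rule assms(1))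

lemma norm_A_le_N: "norm (A x y) \<le> N x * N y"
  using norm_A_le_sup[of y "N y" x] norm_A_curve_le_N[of _ y] N_nonneg[of y] by (simp add: mult.commute)

text \<open>Moves the first argument of a contact pair to the curve: by compactness there is a best
  \<open>s\<close>, and if its value were below 1 then \<open>norm_A_le_sup\<close> would keep
  \<open>A x y\<close> below 1 as well.\<close>

lemma A_attained:
  assumes x: "N x \<le> 1" and y: "N y \<le> 1" and A: "norm (A x y) \<ge> 1"
  obtains s where "s \<in> {0..1}" "norm (A (curve s) y) \<ge> 1"
proof -
  have "continuous_on {0..1} (\<lambda>s. norm (g 0 y - of_real (s\<^sup>2) * g 0 y - g 2 y + 2 * (of_real s * g 1 y)))"
    by (intro continuous_intros)
  then have "continuous_on {0..1} (\<lambda>s. norm (A (curve s) y))"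
    by (rule continuous_on_eq) (simp add: A_def g_curve)
  then obtain s where s: "s \<in> {0..1}" "\<And>t. t \<in> {0..1} \<Longrightarrow> norm (A (curve t) y) \<le> norm (A (curve s) y)"
    using continuous_attains_sup[of "{0..1}" "\<lambda>s. norm (A (curve s) y)"] by auto
  \<comment> \<open>The floor 1/2 guarantees \<open>N y \<le> 2 * r\<close> and is still smaller
    than 1.\<close>
  define r where "r = max (1/2) (norm (A (curve s) y))"
  have "1 \<le> r * N x"
    using norm_A_le_sup[of y r x] s(2) y A by (fastforce simp: r_def le_max_iff_disj)
  also have "\<dots> \<le> r * 1" by (rule mult_left_mono[OF x]) (simp add: r_def)
  finally show ?thesis using that s(1) by (auto simp: r_def max_def split: if_splits)
qed

text \<open>
  Along the curve \<open>A (curve s)\<close> has a quadratic maximum at \<open>s\<close>. A functional vanishing at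
  \<open>curve s\<close> can be added with a small coefficient \<open>\<epsilon>\<close> at the cost of raising the norm by
  only \<open>O(\<epsilon>\<^sup>2)\<close>, hence it must vanish wherever \<open>A (curve s)\<close> attains its norm.
\<close>

lemma dual_vanishes_at_contact:
  assumes s: "s \<in> {0..1}" and y: "N y \<le> 1" and attained: "norm (A (curve s) y) \<ge> 1"
    and f: "f \<in> dual" and fs: "f (curve s) = 0"
  shows "f y = 0"
proof (rule ccontr)
  assume fy: "f y \<noteq> 0"
  obtain E' where E': "\<And>z. norm (f z) \<le> E' * norm z" using f by (auto simp: dual_def)
  define E where "E = max E' 1"
  have E: "norm (f z) \<le> E * norm z" for z
    using E'[of z] mult_right_mono[of E' E "norm z"] by (simp add: E_def)
  have "E \<ge> 1" by (simp add: E_def)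
  have lip: "norm (f (curve t)) \<le> 2 * E * \<bar>s - t\<bar>" if "t \<in> {0..1}" for t
  proof -
    have "norm (f (curve t)) = norm (f (curve t - curve s))" using f fs by (simp add: dual_diff)
    also have "\<dots> \<le> E * norm (curve t - curve s)" by (rule E)
    also have "\<dots> \<le> E * (2 * \<bar>t - s\<bar>)"
      using \<open>E \<ge> 1\<close> by (intro mult_left_mono curve_lipschitz that s) simp
    finally show ?thesis by (simp add: abs_minus_commute)
  qed
  \<comment> \<open>A multiple of \<open>f\<close> with coefficient of modulus
    \<open>\<eta> * q\<close> and matching phase adds exactly \<open>\<eta>\<close> times
    \<open>A (curve s) y\<close> at \<open>y\<close>.\<close>
  define q where "q = norm (A (curve s) y) / norm (f y)"
  have "q > 0" unfolding q_def using attained fy by (intro divide_pos_pos) auto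
  \<comment> \<open>The second entry keeps the perturbation below \<open>D / 2 + 1\<close> on the
    small ball. The first makes the cost \<open>(\<eta> * q * E)^2\<close> at most
    \<open>\<eta> / 2\<close>, so it cannot pay for the gain \<open>\<eta>\<close>.\<close>
  define \<eta> where "\<eta> = min (1 / (2 * (q * E)\<^sup>2)) (1 / (q * E))"
  have "\<eta> > 0" using \<open>q > 0\<close> \<open>E \<ge> 1\<close> by (simp add: \<eta>_def)
  have \<eta>1: "\<eta> * q * E \<le> 1" and \<eta>2: "\<eta> * (q * E)\<^sup>2 \<le> 1/2"
  proof -
    have "\<eta> * (q * E) \<le> 1 / (q * E) * (q * E)" "\<eta> * (q * E)\<^sup>2 \<le> 1 / (2 * (q * E)\<^sup>2) * (q * E)\<^sup>2"
      using \<open>q > 0\<close> \<open>E \<ge> 1\<close> by (intro mult_right_mono; simp add: \<eta>_def)+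
    then show "\<eta> * q * E \<le> 1" "\<eta> * (q * E)\<^sup>2 \<le> 1/2"
      using \<open>q > 0\<close> \<open>E \<ge> 1\<close> by (simp_all add: mult.assoc)
  qed
  define \<epsilon> where "\<epsilon> = of_real \<eta> * (A (curve s) y / f y)"
  have norm_\<epsilon>: "norm \<epsilon> = \<eta> * q" using \<open>\<eta> > 0\<close> by (simp add: \<epsilon>_def q_def norm_mult norm_divide)
  define c where "c = 1 + (\<eta> * q * E)\<^sup>2"
  have "norm (A (curve s) y + \<epsilon> * f y) \<le> c * N y"
  proof (rule norm_le_N[of "\<lambda>y. A (curve s) y + \<epsilon> * f y"])
    show "(\<lambda>y. A (curve s) y + \<epsilon> * f y) \<in> dual"
      by (intro add_in_dual scale_in_dual A_dual f)
    show "c \<ge> 0" by (simp add: c_def)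
    fix t :: real assume t: "t \<in> {0..1}"
    have "norm (A (curve s) (curve t) + \<epsilon> * f (curve t)) \<le> (1 - (s - t)\<^sup>2) + \<eta> * q * (2 * E * \<bar>s - t\<bar>)"
    proof (rule norm_triangle_le, rule add_mono)
      show "norm (A (curve s) (curve t)) \<le> 1 - (s - t)\<^sup>2"
        unfolding A_curve[OF s t] norm_of_real using square_le_one[OF s t] by simp
      show "norm (\<epsilon> * f (curve t)) \<le> \<eta> * q * (2 * E * \<bar>s - t\<bar>)"
        unfolding norm_mult norm_\<epsilon> using \<open>\<eta> > 0\<close> \<open>q > 0\<close> by (intro mult_left_mono lip t) auto
    qed
    also have "\<dots> \<le> c"
      \<comment> \<open>Completing the square in \<open>\<bar>s - t\<bar>\<close>: the quadratic
        loss along the curve beats the linear gain except for a term quadratic in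
        \<open>\<eta>\<close>.\<close>
      using zero_le_power2[of "\<bar>s - t\<bar> - \<eta> * q * E"] by (simp add: c_def power2_diff algebra_simps)
    finally show "norm (A (curve s) (curve t) + \<epsilon> * f (curve t)) \<le> c" .
  next
    fix z :: 'a
    have "norm (A (curve s) z + \<epsilon> * f z) \<le> D / 2 * norm z + \<eta> * q * (E * norm z)"
    proof (rule norm_triangle_le, rule add_mono)
      show "norm (\<epsilon> * f z) \<le> \<eta> * q * (E * norm z)"
        unfolding norm_mult norm_\<epsilon> using \<open>\<eta> > 0\<close> \<open>q > 0\<close> by (intro mult_left_mono E) auto
    qed (rule norm_A_curve_le[OF s])
    also have "\<dots> \<le> (D / 2 + 1) * norm z"
      using mult_right_mono[OF \<eta>1, of "norm z"] by (simp add: algebra_simps)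
    also have "\<dots> \<le> (1 * D) * norm z" using C_ge by (intro mult_right_mono) auto
    also have "\<dots> \<le> c * D * norm z" using C_ge by (intro mult_right_mono) (auto simp: c_def)
    finally show "norm (A (curve s) z + \<epsilon> * f z) \<le> c * D * norm z" .
  qed
  also have "\<dots> \<le> c" using mult_left_mono[OF y, of c] by (simp add: c_def)
  also have "A (curve s) y + \<epsilon> * f y = of_real (1 + \<eta>) * A (curve s) y"
    using fy by (simp add: \<epsilon>_def algebra_simps)
  finally have "(1 + \<eta>) * norm (A (curve s) y) \<le> c"
    using \<open>\<eta> > 0\<close> unfolding norm_mult norm_of_real by simp
  moreover have "(1 + \<eta>) * 1 \<le> (1 + \<eta>) * norm (A (curve s) y)"
    using \<open>\<eta> > 0\<close> by (intro mult_left_mono attained) auto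
  ultimately have "\<eta> \<le> \<eta> * (\<eta> * (q * E)\<^sup>2)" by (simp add: c_def power2_eq_square mult_ac)
  also have "\<dots> \<le> \<eta> * (1/2)" using \<open>\<eta> > 0\<close> by (intro mult_left_mono \<eta>2) auto
  finally show False using \<open>\<eta> > 0\<close> by simp
qed

text \<open>Since \<open>g 0\<close> is 1 on the curve, \<open>f\<close> minus
  \<open>f (curve s)\<close> times \<open>g 0\<close> vanishes at \<open>curve s\<close>, hence at
  \<open>y\<close>. So bounded functionals cannot tell \<open>y\<close> from the multiple
  \<open>g 0 y\<close> of \<open>curve s\<close>.\<close>

lemma dual_at_contact:
  assumes s: "s \<in> {0..1}" and y: "N y \<le> 1" and attained: "norm (A (curve s) y) \<ge> 1" and f: "f \<in> dual"
  shows "f y = f (curve s) * g 0 y"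
proof -
  have "f y - f (curve s) * g 0 y = 0"
    by (rule dual_vanishes_at_contact[OF s y attained, of "\<lambda>y. f y - f (curve s) * g 0 y"])
      (use s in \<open>auto intro!: diff_in_dual scale_in_dual f g_dual simp: g_curve\<close>)
  then show ?thesis by simp
qed

lemma norm_g_le_N: "norm (g 0 x) \<le> N x"
proof (rule N_upper)
  have "norm (g 0 z) \<le> D * norm z" for z
  proof -
    have "C * norm z \<le> D * norm z" by (rule mult_right_mono) (use C_ge in auto)
    then show ?thesis using g_bound[of 0 z] by linarith
  qed
  then show "g 0 \<in> norming_set"
    by (simp add: norming_set_def g_dual g_curve)
qed

text \<open>Both arguments touch at the same \<open>s\<close>, and each is a scalar multiple of
  \<open>curve s\<close> for all functionals. The two scalars have product \<open>A x y = 1\<close>,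
  so they cancel in the tensor product.\<close>

theorem contact_on_curve:
  assumes x: "N x \<le> 1" and y: "N y \<le> 1" and A: "A x y = 1"
  obtains s where "s \<in> {0..1}"
    "\<And>f h. f \<in> dual \<Longrightarrow> h \<in> dual \<Longrightarrow> f x * h y = f (curve s) * h (curve s)"
proof -
  obtain s where s: "s \<in> {0..1}" and sy: "norm (A (curve s) y) \<ge> 1"
    using A_attained[OF x y] A by auto
  have A_split: "A x (curve s) * g 0 y = 1"
    using dual_at_contact[OF s y sy A_dual, of x] A by simp
  have "1 = norm (A x (curve s)) * norm (g 0 y)"
    using A_split by (metis norm_mult norm_one)
  \<comment> \<open>Because \<open>g 0 y\<close> has modulus at most one, the other factor carries
    the full value; by symmetry of \<open>A\<close> this is a contact of \<open>x\<close> at the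
    same \<open>s\<close>.\<close>
  also have "\<dots> \<le> norm (A x (curve s)) * 1"
    using norm_g_le_N[of y] y by (intro mult_left_mono) auto
  finally have sx: "norm (A (curve s) x) \<ge> 1" by (simp add: A_commute)
  have "A (curve s) x = g 0 x"
    using dual_at_contact[OF s x sx A_dual, of "curve s"] A_curve[OF s s] by simp
  then have gg: "g 0 x * g 0 y = 1" using A_split by (simp add: A_commute)
  show ?thesis
  proof (rule that[OF s])
    fix f h assume "f \<in> dual" "h \<in> dual"
    then have "f x * h y = (f (curve s) * g 0 x) * (h (curve s) * g 0 y)"
      using dual_at_contact[OF s x sx, of f] dual_at_contact[OF s y sy, of h] by simp
    also have "\<dots> = f (curve s) * h (curve s) * (g 0 x * g 0 y)" by (simp only: mult_ac)
    finally show "f x * h y = f (curve s) * h (curve s)" by (simp add: gg)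
  qed
qed

end

subsection \<open>The tensor of the curve\<close>

lemma space_borel_of: "space (borel_of T) = topspace T"
  by (simp add: borel_of_def space_measure_of_conv)

lemma openin_in_sets_borel_of: "openin T U \<Longrightarrow> U \<in> sets (borel_of T)"
  unfolding borel_of_def by (subst sets_measure_of) (auto dest: openin_subset)

lemma closedin_in_sets_borel_of:
  assumes "closedin T S" shows "S \<in> sets (borel_of T)"
proof -
  have "topspace T - (topspace T - S) \<in> sets (borel_of T)"
    using assms sets.compl_sets[OF openin_in_sets_borel_of] by (fastforce simp: closedin_def space_borel_of)
  then show ?thesis using closedin_subset[OF assms] by (simp add: double_diff)
qed

lemma measurable_borel_of:
  assumes f: "f \<in> space M \<rightarrow> topspace T" and "\<And>U. openin T U \<Longrightarrow> f -` U \<inter> space M \<in> sets M"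
  shows "f \<in> measurable M (borel_of T)"
  unfolding borel_of_def by (rule measurable_measure_of) (use assms in \<open>auto dest: openin_subset\<close>)

lemma continuous_on_measurable_borel_of:
  fixes f :: "'a::topological_space \<Rightarrow> 'b::topological_space"
  assumes "continuous_on S f"
  shows "f \<in> borel_measurable (borel_of (top_of_set S))"
proof (rule borel_measurableI)
  fix U :: "'b set" assume "open U"
  then have "openin (top_of_set S) (S \<inter> f -` U)"
    using assms by (simp add: continuous_openin_preimage_gen)
  then show "f -` U \<inter> space (borel_of (top_of_set S)) \<in> sets (borel_of (top_of_set S))"
    using openin_in_sets_borel_of[of "top_of_set S" "S \<inter> f -` U"]
    by (simp add: space_borel_of Int_commute)
qed

context moment_curve
begin

interpretation sc: vector_space sc
  by (rule vector_space_sc)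

sublocale pt: normed_projective_tensor sc N sc N
  by unfold_locales (auto simp: is_norm_N vector_space_sc[unfolded vector_space_def])

lemma N_minus: "N (- x) = N x"
  using pt.NX_scale[of "- 1" x] by simp

lemma N_diff_commute: "N (x - y) = N (y - x)"
  using N_minus[of "x - y"] by simp

text \<open>Equivalent norms have the same open sets. Afterwards the ball topology is a subspace of
  the type class topology, where continuity and compactness arguments are available.\<close>

lemma norm_topology_eq: "norm_topology N = euclidean"
proof -
  interpret m: Metric_space UNIV "\<lambda>x y. N (x - y)"
  proof
    fix x y z
    show "N (x - y) = N (y - x)" by (rule N_diff_commute)
    show "N (x - y) = 0 \<longleftrightarrow> x = y" using is_norm_N by (simp add: is_norm_def)
    have "N (x - y + (y - z)) \<le> N (x - y) + N (y - z)" using is_norm_N unfolding is_norm_def by blast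
    then show "N (x - z) \<le> N (x - y) + N (y - z)" by simp
  qed (rule N_nonneg)
  have "openin m.mtopology S \<longleftrightarrow> open S" for S
  proof
    assume S: "openin m.mtopology S"
    show "open S"
      unfolding open_dist
    proof
      fix x assume "x \<in> S"
      then obtain r where r: "r > 0" "m.mball x r \<subseteq> S" using S by (auto simp: m.openin_mtopology)
      have "y \<in> S" if "dist y x < r / D" for y
      proof -
        have "N (x - y) \<le> D * norm (x - y)" by (rule N_le)
        also have "\<dots> < D * (r / D)"
          using that C_ge by (intro mult_strict_left_mono) (auto simp: dist_norm norm_minus_commute)
        also have "\<dots> = r" using C_ge by simp
        finally show ?thesis using r by auto
      qed
      moreover have "r / D > 0" using r C_ge by simp
      ultimately show "\<exists>e>0. \<forall>y. dist y x < e \<longrightarrow> y \<in> S" by blast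
    qed
  next
    assume S: "open S"
    show "openin m.mtopology S"
      unfolding m.openin_mtopology
    proof (intro conjI allI impI)
      fix x assume "x \<in> S"
      then obtain r where r: "r > 0" "\<And>y. dist y x < r \<Longrightarrow> y \<in> S" using S by (auto simp: open_dist)
      have "m.mball x (r / 6) \<subseteq> S"
      proof
        fix y assume "y \<in> m.mball x (r / 6)"
        then have "dist y x < r" using N_ge[of "x - y"] by (simp add: dist_norm norm_minus_commute)
        then show "y \<in> S" by (rule r(2))
      qed
      then show "\<exists>r>0. m.mball x r \<subseteq> S" using r(1) by (intro exI[of _ "r / 6"]) auto
    qed auto
  qed
  then show ?thesis unfolding norm_topology_def by (simp add: topology_eq)
qed

abbreviation balls :: "('a \<times> 'a) set" where "balls \<equiv> unit_ball N \<times> unit_ball N"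

lemma ball_topology_eq: "pt.ball_topology = top_of_set balls"
  by (simp add: pt.ball_topology_def norm_topology_eq prod_topology_subtopology_eu)

section \<open>Riemann sums and the norm of their limit\<close>

definition sq :: "real \<Rightarrow> ('a \<Rightarrow> 'a \<Rightarrow> 'k) \<Rightarrow> 'k" where
  "sq t = pt.tensor (curve t) (curve t)"

lemma sq_in: "sq t \<in> pt.alg_tensor"
  by (simp add: sq_def pt.tensor_in)

lemma sq_lipschitz:
  assumes s: "s \<in> {0..1}" and t: "t \<in> {0..1}"
  shows "pt.proj_norm (sq s - sq t) \<le> 4 * D * \<bar>s - t\<bar>"
proof -
  have eq: "sq s - sq t = pt.tensor (curve s - curve t) (curve s) + pt.tensor (curve t) (curve s - curve t)"
    by (simp add: sq_def pt.tensor_diff_left pt.tensor_diff_right)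
  have "pt.proj_norm (sq s - sq t) \<le> N (curve s - curve t) * N (curve s) + N (curve t) * N (curve s - curve t)"
    unfolding eq by (intro order_trans[OF pt.proj_norm_triangle] add_mono pt.tensor_in pt.proj_norm_tensor_le)
  also have "\<dots> \<le> N (curve s - curve t) * 1 + 1 * N (curve s - curve t)"
    using N_curve_le[OF s] N_curve_le[OF t] N_nonneg by (intro add_mono mult_left_mono mult_right_mono) auto
  also have "\<dots> \<le> 2 * (D * norm (curve s - curve t))" using N_le[of "curve s - curve t"] by simp
  also have "\<dots> \<le> 2 * (D * (2 * \<bar>s - t\<bar>))"
    using C_ge by (intro mult_left_mono curve_lipschitz s t) auto
  finally show ?thesis by simp
qed

definition riemann :: "nat \<Rightarrow> ('a \<Rightarrow> 'a \<Rightarrow> 'k) \<Rightarrow> 'k" where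
  "riemann m = (\<Sum>i<m. pt.tensor_scale (of_real (1 / real m)) (sq (real i / real m)))"

lemma riemann_in: "riemann m \<in> pt.alg_tensor"
  unfolding riemann_def by (intro pt.hat.sum_in pt.hat.scale_in sq_in)

text \<open>Each coarse summand is split into \<open>n\<close> equal ones. The fine index
  \<open>l\<close> then belongs to the coarse node \<open>l div n\<close>, and the two nodes differ
  by at most \<open>1 / m\<close>.\<close>

lemma riemann_refine:
  assumes m: "m > 0" and n: "n > 0"
  shows "pt.proj_norm (riemann m - riemann (m * n)) \<le> 4 * D / m"
proof -
  interpret ts: vector_space pt.tensor_scale by (rule pt.vector_space_tensor_scale)
  define c where "c = 1 / real (m * n)"
  have "c \<ge> 0" by (simp add: c_def)
  have "riemann m = (\<Sum>i<m. \<Sum>l\<in>{i * n..<i * n + n}. pt.tensor_scale (of_real c) (sq (real (l div n) / real m)))"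
    unfolding riemann_def
  proof (rule sum.cong[OF refl])
    fix i assume "i \<in> {..<m}"
    have "l div n = i" if "l \<in> {i * n..<i * n + n}" for l
      using that n by (intro div_nat_eqI) (auto simp: mult.commute)
    then have "(\<Sum>l\<in>{i * n..<i * n + n}. pt.tensor_scale (of_real c) (sq (real (l div n) / real m)))
        = (\<Sum>l\<in>{i * n..<i * n + n}. pt.tensor_scale (of_real c) (sq (real i / real m)))"
      by (intro sum.cong) auto
    also have "\<dots> = pt.tensor_scale (\<Sum>l\<in>{i * n..<i * n + n}. of_real c) (sq (real i / real m))"
      by (rule ts.scale_sum_left[symmetric])
    also have "(\<Sum>l\<in>{i * n..<i * n + n}. of_real c) = (of_real (real n * c) :: 'k)"
      by simp
    also have "real n * c = 1 / real m" using n by (simp add: c_def)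
    finally show "pt.tensor_scale (of_real (1 / real m)) (sq (real i / real m)) =
        (\<Sum>l\<in>{i * n..<i * n + n}. pt.tensor_scale (of_real c) (sq (real (l div n) / real m)))" by simp
  qed
  also have "\<dots> = (\<Sum>l<m * n. pt.tensor_scale (of_real c) (sq (real (l div n) / real m)))"
    by (rule sum.nat_group)
  finally have eq: "riemann m - riemann (m * n) =
      (\<Sum>l<m * n. pt.tensor_scale (of_real c) (sq (real (l div n) / real m) - sq (real l / real (m * n))))"
    by (simp add: riemann_def c_def sum_subtractf ts.scale_right_diff_distrib)
  have "pt.proj_norm (riemann m - riemann (m * n)) \<le> (\<Sum>l<m * n. c * (4 * D * (1 / m)))"
    unfolding eq
  proof (rule order_trans[OF pt.hat.p_sum_le sum_mono])
    fix l assume "l \<in> {..<m * n}"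
    then have l: "l < m * n" by simp
    then have "l div n < m" using n by (simp add: less_mult_imp_div_less)
    then have u: "real (l div n) / real m \<in> {0..1}" "real l / real (m * n) \<in> {0..1}"
      using l m n by (auto simp: divide_le_eq_1 simp del: of_nat_mult)
    have "real l = real n * real (l div n) + real (l mod n)"
      by (metis mult_div_mod_eq of_nat_add of_nat_mult)
    then have "real l / real (m * n) - real (l div n) / real m = real (l mod n) / real (m * n)"
      using m n by (simp add: field_simps)
    also have "\<dots> \<le> real n / real (m * n)"
      using n mod_less_divisor[OF n, of l] by (intro divide_right_mono) auto
    also have "\<dots> = 1 / m" using n by simp
    finally have "real l / real (m * n) - real (l div n) / real m \<le> 1 / m" .
    moreover have "real l / real (m * n) - real (l div n) / real m \<ge> 0"
      using \<open>_ = real (l mod n) / real (m * n)\<close> by simp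
    ultimately have dist: "\<bar>real (l div n) / real m - real l / real (m * n)\<bar> \<le> 1 / m" by linarith
    have "pt.proj_norm (pt.tensor_scale (of_real c) (sq (real (l div n) / real m) - sq (real l / real (m * n))))
        \<le> c * pt.proj_norm (sq (real (l div n) / real m) - sq (real l / real (m * n)))"
      using pt.hat.p_scale_le[OF pt.hat.diff_in[OF sq_in sq_in], of "of_real c"] \<open>c \<ge> 0\<close> by simp
    also have "\<dots> \<le> c * (4 * D * \<bar>real (l div n) / real m - real l / real (m * n)\<bar>)"
      using u by (intro mult_left_mono sq_lipschitz \<open>c \<ge> 0\<close>)
    also have "\<dots> \<le> c * (4 * D * (1 / m))"
      using C_ge \<open>c \<ge> 0\<close> by (intro mult_left_mono dist) auto
    finally show "pt.proj_norm (pt.tensor_scale (of_real c) (sq (real (l div n) / real m) - sq (real l / real (m * n))))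
        \<le> c * (4 * D * (1 / m))" .
  qed (intro pt.hat.scale_in pt.hat.diff_in sq_in)
  also have "\<dots> = 4 * D / m" using m n by (simp add: c_def)
  finally show ?thesis .
qed

text \<open>The sums for \<open>m\<close> and \<open>n\<close> are compared through their common
  refinement \<open>m * n\<close>.\<close>

lemma riemann_cauchy: "riemann \<in> pt.hat.cauchy_seqs"
  unfolding pt.hat.cauchy_seqs_def
proof (intro CollectI conjI allI impI)
  show "range riemann \<subseteq> pt.alg_tensor" using riemann_in by auto
  fix \<epsilon> :: real assume \<epsilon>: "\<epsilon> > 0"
  obtain M :: nat where M: "8 * D / \<epsilon> < real M" using reals_Archimedean2 by blast
  have "8 * D / \<epsilon> > 0" using \<epsilon> C_ge by simp
  then have "M > 0" using M by linarith
  have half: "4 * D / m < \<epsilon> / 2" if "m \<ge> M" for m :: nat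
  proof -
    have "8 * D < real M * \<epsilon>" using M \<epsilon> by (simp add: pos_divide_less_eq)
    also have "\<dots> \<le> real m * \<epsilon>" using that \<epsilon> by (intro mult_right_mono) auto
    finally show ?thesis using that \<open>M > 0\<close> by (simp add: field_simps)
  qed
  show "\<exists>M. \<forall>m\<ge>M. \<forall>n\<ge>M. pt.proj_norm (riemann m - riemann n) < \<epsilon>"
  proof (intro exI[of _ M] allI impI)
    fix m n assume mn: "m \<ge> M" "n \<ge> M"
    then have "m > 0" "n > 0" using \<open>M > 0\<close> by auto
    have "pt.proj_norm (riemann m - riemann n)
        \<le> pt.proj_norm (riemann m - riemann (m * n)) + pt.proj_norm (riemann (m * n) - riemann n)"
      by (intro pt.hat.p_diff_triangle riemann_in)
    also have "pt.proj_norm (riemann (m * n) - riemann n) = pt.proj_norm (riemann n - riemann (n * m))"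
      by (simp add: pt.hat.p_diff_commute riemann_in mult.commute)
    finally show "pt.proj_norm (riemann m - riemann n) < \<epsilon>"
      using riemann_refine[OF \<open>m > 0\<close> \<open>n > 0\<close>] riemann_refine[OF \<open>n > 0\<close> \<open>m > 0\<close>] half[OF mn(1)] half[OF mn(2)]
      by linarith
  qed
qed

definition curve_tensor :: "(nat \<Rightarrow> ('a \<Rightarrow> 'a \<Rightarrow> 'k) \<Rightarrow> 'k) set" where
  "curve_tensor = pt.hat.cls riemann"

lemma curve_tensor_in: "curve_tensor \<in> pt.hat.points"
  by (simp add: curve_tensor_def pt.hat.cls_in_points riemann_cauchy)

lemma dual_linear: "f \<in> dual \<Longrightarrow> Vector_Spaces.linear sc (*) f"
  by (auto simp: Vector_Spaces.linear_iff dual_add dual_scale vector_space_sc vector_space_def algebra_simps)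

lemma bilinear_formsI: "(\<And>y. (\<lambda>x. B x y) \<in> dual) \<Longrightarrow> (\<And>x. B x \<in> dual) \<Longrightarrow> B \<in> pt.bilinear_forms"
  by (simp add: pt.bilinear_forms_def dual_linear)

lemma A_bilinear: "A \<in> pt.bilinear_forms"
  by (intro bilinear_formsI A_dual A_dual')

lemma product_bilinear:
  assumes "f \<in> dual" "h \<in> dual"
  shows "(\<lambda>x y. f x * h y) \<in> pt.bilinear_forms"
proof (rule bilinear_formsI)
  show "(\<lambda>x. f x * h y) \<in> dual" for y
    using scale_in_dual[OF assms(1), of "h y"] by (simp add: mult.commute)
qed (rule scale_in_dual[OF assms(2)])

lemma dual_le_N:
  assumes "f \<in> dual"
  obtains K where "K \<ge> 0" "\<And>z. norm (f z) \<le> K * N z"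
proof -
  obtain E where E: "\<And>z. norm (f z) \<le> E * norm z" using assms by (auto simp: dual_def)
  show ?thesis
  proof (rule that[of "6 * max E 0"])
    fix z
    have "norm (f z) \<le> max E 0 * norm z"
      using E[of z] mult_right_mono[of E "max E 0" "norm z"] by simp
    also have "\<dots> \<le> max E 0 * (6 * N z)" using N_ge[of z] by (intro mult_left_mono) auto
    finally show "norm (f z) \<le> 6 * max E 0 * N z" by simp
  qed simp
qed

lemma norm_apply_A_le: "v \<in> pt.alg_tensor \<Longrightarrow> norm (v A) \<le> pt.proj_norm v"
  using pt.norm_apply_le[OF A_bilinear, of 1 v] norm_A_le_N by simp

lemma norm_apply_product_le:
  assumes f: "f \<in> dual" and h: "h \<in> dual"
  obtains K where "K \<ge> 0" "\<And>v. v \<in> pt.alg_tensor \<Longrightarrow> norm (v (\<lambda>x y. f x * h y)) \<le> K * pt.proj_norm v"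
proof -
  obtain K where K: "K \<ge> 0" "\<And>z. norm (f z) \<le> K * N z" using dual_le_N[OF f] by blast
  obtain L where L: "L \<ge> 0" "\<And>z. norm (h z) \<le> L * N z" using dual_le_N[OF h] by blast
  have "norm (f x * h y) \<le> K * L * (N x * N y)" for x y
  proof -
    have "norm (f x) * norm (h y) \<le> (K * N x) * (L * N y)"
      using K L N_nonneg by (intro mult_mono) auto
    then show ?thesis by (simp add: norm_mult mult_ac)
  qed
  then show ?thesis
    using that[of "K * L"] pt.norm_apply_le[OF product_bilinear[OF f h], of "K * L"] K L by auto
qed

lemma riemann_apply:
  assumes "B \<in> pt.bilinear_forms"
  shows "riemann m B = (\<Sum>i<m. of_real (1 / real m) * B (curve (real i / real m)) (curve (real i / real m)))"
  by (simp add: riemann_def pt.sum_apply pt.tensor_scale_def sq_def pt.tensor_apply assms)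

lemma grid_in: "i < m \<Longrightarrow> real i / real m \<in> {0..1}"
  by (auto simp: divide_le_eq_1)

lemma riemann_A: "m > 0 \<Longrightarrow> riemann m A = 1"
  by (simp add: riemann_apply A_bilinear A_curve grid_in)

text \<open>An average of tensors of norm at most one has norm at most one, and \<open>A\<close>,
  which has norm one, takes the value 1 on it. Both bounds are exact for every \<open>m\<close> and
  so survive the limit.\<close>

lemma proj_norm_riemann:
  assumes "m > 0"
  shows "pt.proj_norm (riemann m) = 1"
proof (rule antisym)
  have "pt.proj_norm (riemann m) \<le> (\<Sum>i<m. pt.proj_norm (pt.tensor_scale (of_real (1 / real m)) (sq (real i / real m))))"
    unfolding riemann_def by (intro pt.hat.p_sum_le pt.hat.scale_in sq_in)
  also have "\<dots> \<le> (\<Sum>i<m. 1 / real m)"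
  proof (rule sum_mono)
    fix i assume i: "i \<in> {..<m}"
    have "pt.proj_norm (sq (real i / real m)) \<le> N (curve (real i / real m)) * N (curve (real i / real m))"
      unfolding sq_def by (rule pt.proj_norm_tensor_le)
    also have "\<dots> \<le> 1 * 1"
      using i by (intro mult_mono N_curve_le grid_in N_nonneg) auto
    finally have "(1 / real m) * pt.proj_norm (sq (real i / real m)) \<le> (1 / real m) * 1"
      by (intro mult_left_mono) auto
    then show "pt.proj_norm (pt.tensor_scale (of_real (1 / real m)) (sq (real i / real m))) \<le> 1 / real m"
      using pt.hat.p_scale_le[OF sq_in, of "of_real (1 / real m)" "real i / real m"]
      unfolding norm_of_real by simp
  qed
  also have "\<dots> = 1" using assms by simp
  finally show "pt.proj_norm (riemann m) \<le> 1" .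
  show "1 \<le> pt.proj_norm (riemann m)"
    using norm_apply_A_le[OF riemann_in, of m] riemann_A[OF assms] by simp
qed

lemma cnorm_curve_tensor: "pt.hat.cnorm curve_tensor = 1"
proof -
  have "eventually (\<lambda>m. pt.proj_norm (riemann m) = 1) sequentially"
    using eventually_gt_at_top[of 0] by eventually_elim (rule proj_norm_riemann)
  then have "(\<lambda>m. pt.proj_norm (riemann m)) \<longlonglongrightarrow> 1" by (rule tendsto_eventually)
  then show ?thesis
    using pt.hat.cnorm_cls[OF riemann_cauchy] LIMSEQ_unique unfolding curve_tensor_def by blast
qed

end

subsection \<open>The representing measure\<close>

context moment_curve
begin

text \<open>Makes the diagonal curve continuous on the whole real line, which is the space of
  \<open>unif\<close>.\<close>

definition clamp01 :: "real \<Rightarrow> real" where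
  "clamp01 t = max 0 (min 1 t)"

lemma clamp01_in: "clamp01 t \<in> {0..1}"
  by (auto simp: clamp01_def)

lemma clamp01_eq: "t \<in> {0..1} \<Longrightarrow> clamp01 t = t"
  by (auto simp: clamp01_def)

definition diag :: "real \<Rightarrow> 'a \<times> 'a" where
  "diag t = (curve (clamp01 t), curve (clamp01 t))"

lemma diag_in: "diag t \<in> balls"
  using N_curve_le[OF clamp01_in] by (simp add: diag_def unit_ball_def)

lemma continuous_on_curve: "continuous_on {0..1} curve"
proof (rule continuous_onI)
  fix s e :: real assume s: "s \<in> {0..1}" "e > 0"
  have "dist (curve t) (curve s) \<le> e" if "t \<in> {0..1}" "dist t s < e / 2" for t
    using curve_lipschitz[OF that(1) s(1)] that(2) by (simp add: dist_norm)
  then show "\<exists>d>0. \<forall>t\<in>{0..1}. dist t s < d \<longrightarrow> dist (curve t) (curve s) \<le> e"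
    using s by (intro exI[of _ "e / 2"]) auto
qed

lemma continuous_on_diag: "continuous_on UNIV diag"
proof -
  have "continuous_on UNIV clamp01" unfolding clamp01_def by (intro continuous_intros)
  then have "continuous_on UNIV (\<lambda>t. curve (clamp01 t))"
    using clamp01_in by (intro continuous_on_compose2[OF continuous_on_curve]) auto
  then show ?thesis unfolding diag_def by (intro continuous_on_Pair)
qed

text \<open>The half-open interval is the disjoint union of the intervals
  \<open>{i / m..<(i + 1) / m}\<close>, so each cell has mass exactly \<open>1 / m\<close>.\<close>

abbreviation unif :: "real measure" where
  "unif \<equiv> uniform_measure lborel {0..<1}"

lemma prob_space_unif: "prob_space unif"
  by (rule prob_space_uniform_measure) auto

lemma emeasure_unif: "S \<in> sets borel \<Longrightarrow> emeasure unif S = emeasure lborel ({0..<1} \<inter> S)"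
  by (subst emeasure_uniform_measure) (auto simp: divide_ennreal_def)

definition diag_measure :: "('a \<times> 'a) measure" where
  "diag_measure = distr unif (borel_of pt.ball_topology) diag"

lemma space_borel_of_ball: "space (borel_of pt.ball_topology) = balls"
  by (simp add: space_borel_of ball_topology_eq)

lemma diag_measurable: "diag \<in> measurable unif (borel_of pt.ball_topology)"
proof (rule measurable_borel_of)
  show "diag \<in> space unif \<rightarrow> topspace pt.ball_topology"
    using diag_in by (auto simp: ball_topology_eq)
  fix U assume "openin pt.ball_topology U"
  then obtain S where S: "open S" "U = balls \<inter> S" by (auto simp: ball_topology_eq openin_open)
  have "diag -` U = diag -` S" using diag_in by (auto simp: S(2))
  moreover have "open (diag -` S)" by (rule open_vimage[OF S(1) continuous_on_diag])
  ultimately show "diag -` U \<inter> space unif \<in> sets unif" by simp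
qed

lemma sets_diag_measure: "sets diag_measure = sets (borel_of pt.ball_topology)"
  and space_diag_measure: "space diag_measure = balls"
  by (simp_all add: diag_measure_def space_borel_of_ball)

lemma prob_space_diag_measure: "prob_space diag_measure"
  unfolding diag_measure_def by (rule prob_space.prob_space_distr[OF prob_space_unif diag_measurable])

lemma diag_vimage_borel: "S \<in> sets diag_measure \<Longrightarrow> diag -` S \<in> sets borel"
  using measurable_sets[OF diag_measurable, of S] by (simp add: sets_diag_measure)

lemma emeasure_diag_measure:
  assumes "S \<in> sets diag_measure"
  shows "emeasure diag_measure S = emeasure unif (diag -` S)"
  using emeasure_distr[OF diag_measurable, of S] assms
  by (simp add: diag_measure_def)

lemma compact_in_sets:
  assumes "compact K" "K \<subseteq> balls"
  shows "K \<in> sets diag_measure"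
  unfolding sets_diag_measure
  by (rule closedin_in_sets_borel_of)
    (use assms in \<open>auto simp: ball_topology_eq intro: closed_subset compact_imp_closed\<close>)

lemma radon_diag_measure: "radon_measure pt.ball_topology diag_measure"
  unfolding radon_measure_def
proof (intro conjI ballI)
  interpret prob_space diag_measure by (rule prob_space_diag_measure)
  show "sets diag_measure = sets (borel_of pt.ball_topology)" by (rule sets_diag_measure)
  show "\<exists>U. openin pt.ball_topology U \<and> x \<in> U \<and> emeasure diag_measure U < \<infinity>"
    if "x \<in> topspace pt.ball_topology" for x
    using that by (intro exI[of _ "topspace pt.ball_topology"]) (auto simp: emeasure_eq_measure)
  fix S assume S: "S \<in> sets diag_measure"
  have compactin: "compactin pt.ball_topology K \<longleftrightarrow> compact K \<and> K \<subseteq> balls" for K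
    by (auto simp: ball_topology_eq compactin_subtopology)
  let ?R = "SUP K\<in>{K. compactin pt.ball_topology K \<and> K \<subseteq> S}. emeasure diag_measure K"
  show "emeasure diag_measure S = ?R"
  proof (rule antisym)
    have "emeasure diag_measure S = (SUP K\<in>{K. K \<subseteq> diag -` S \<and> compact K}. emeasure unif K)"
      unfolding emeasure_diag_measure[OF S]
    proof (rule inner_regular)
      show "emeasure unif (space unif) \<noteq> \<infinity>"
        using prob_space.emeasure_space_1[OF prob_space_unif] by simp
    qed (use diag_vimage_borel[OF S] in auto)
    also have "\<dots> \<le> ?R"
    proof (rule SUP_least)
      fix K assume "K \<in> {K. K \<subseteq> diag -` S \<and> compact K}"
      then have K: "K \<subseteq> diag -` S" "compact K" by auto
      have dK: "compact (diag ` K)" "diag ` K \<subseteq> S" "diag ` K \<subseteq> balls"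
        using K diag_in compact_continuous_image[OF continuous_on_subset[OF continuous_on_diag subset_UNIV]]
        by blast+
      then have sets: "diag ` K \<in> sets diag_measure" by (intro compact_in_sets)
      have "emeasure unif K \<le> emeasure unif (diag -` (diag ` K))"
        using diag_vimage_borel[OF sets] by (intro emeasure_mono) auto
      also have "\<dots> = emeasure diag_measure (diag ` K)" by (rule emeasure_diag_measure[OF sets, symmetric])
      also have "\<dots> \<le> ?R" using dK by (intro SUP_upper) (auto simp: compactin)
      finally show "emeasure unif K \<le> ?R" .
    qed
    finally show "emeasure diag_measure S \<le> ?R" .
    show "?R \<le> emeasure diag_measure S"
      by (intro SUP_least emeasure_mono) (use S in auto)
  qed
qed

text \<open>Recovers the curve parameter, as \<open>g 1 (curve t)\<close> is \<open>t\<close> and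
  \<open>inner _ 1\<close> takes the real part. Being continuous on all pairs, it yields measurable
  cells off the curve too.\<close>

definition param :: "'a \<times> 'a \<Rightarrow> real" where
  "param p = inner (g 1 (fst p)) 1"

lemma param_measurable: "param \<in> borel_measurable diag_measure"
proof -
  have "continuous_on balls param"
    unfolding param_def
    by (intro continuous_intros bounded_linear.continuous_on[OF dual_bounded_linear[OF g_dual]])
  from continuous_on_measurable_borel_of[OF this] show ?thesis
    by (simp add: measurable_cong_sets[OF sets_diag_measure refl] ball_topology_eq)
qed

lemma param_curve: "t \<in> {0..1} \<Longrightarrow> param (curve t, y) = t"
  by (simp add: param_def g_curve of_real_def dot_square_norm)

text \<open>\<open>nat\<close> and the cap \<open>m - 1\<close> keep the index in range for
  arbitrary pairs, and put the end point \<open>t = 1\<close> into the last cell.\<close>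

definition cell :: "nat \<Rightarrow> 'a \<times> 'a \<Rightarrow> nat" where
  "cell m p = min (nat \<lfloor>real m * param p\<rfloor>) (m - 1)"

lemma cell_less: "m > 0 \<Longrightarrow> cell m p < m"
  by (auto simp: cell_def)

lemma cell_sets: "{p \<in> space diag_measure. cell m p \<in> S} \<in> sets diag_measure"
proof -
  have "cell m \<in> measurable diag_measure (count_space UNIV)"
    unfolding cell_def using param_measurable by measurable
  from measurable_sets[OF this, of S] show ?thesis by (simp add: vimage_def Int_def conj_commute)
qed

lemma cell_diag:
  assumes m: "m > 0" and t: "t \<in> {0..1}"
  shows "\<bar>real (cell m (curve t, y)) / real m - t\<bar> \<le> 1 / m"
proof -
  have r: "real m * t \<le> real m" "real m * t \<ge> 0"
    using t mult_left_mono[of t 1 "real m"] by simp_all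
  have "\<bar>real (cell m (curve t, y)) - real m * t\<bar> \<le> 1"
  proof (cases "real m * t < real m")
    case True
    then have "nat \<lfloor>real m * t\<rfloor> \<le> m - 1" using m by linarith
    then have "cell m (curve t, y) = nat \<lfloor>real m * t\<rfloor>" using t by (simp add: cell_def param_curve)
    then show ?thesis using r by linarith
  next
    case False
    then have "real m * t = real m" using r by simp
    then show ?thesis using m t by (simp add: cell_def param_curve)
  qed
  then have "\<bar>real (cell m (curve t, y)) - real m * t\<bar> / real m \<le> 1 / real m"
    by (rule divide_right_mono) simp
  moreover have "real (cell m (curve t, y)) / real m - t = (real (cell m (curve t, y)) - real m * t) / real m"
    using m by (simp add: field_simps)
  ultimately show ?thesis by simp
qed

lemma emeasure_cell:
  assumes "i < m"
  shows "emeasure diag_measure {p \<in> space diag_measure. cell m p = i} = ennreal (1 / m)"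
proof -
  have m: "m > 0" using assms by simp
  let ?S = "{p \<in> space diag_measure. cell m p = i}"
  have S: "?S \<in> sets diag_measure" using cell_sets[of m "{i}"] by simp
  have "{0..<1} \<inter> diag -` ?S = {real i / m..<(real i + 1) / m}"
  proof (intro set_eqI iffI)
    fix t assume "t \<in> {0..<1} \<inter> diag -` ?S"
    then have t: "t \<in> {0..1}" "t < 1" "cell m (diag t) = i" by auto
    have "real m * t < real m * 1" using t(2) m by (intro mult_strict_left_mono) auto
    moreover have "real m * t \<ge> 0" using t by simp
    moreover have "min (nat \<lfloor>real m * t\<rfloor>) (m - 1) = i"
      using t by (simp add: diag_def clamp01_eq cell_def param_curve)
    ultimately have "real i \<le> real m * t" "real m * t < real i + 1"
      using m by (auto simp: min_def nat_less_iff split: if_splits) linarith+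
    then show "t \<in> {real i / m..<(real i + 1) / m}" using m by (simp add: field_simps)
  next
    fix t assume "t \<in> {real i / m..<(real i + 1) / m}"
    then have "real i \<le> real m * t" "real m * t < real i + 1" using m by (auto simp: field_simps)
    moreover have "real i + 1 \<le> real m" using assms by linarith
    moreover from calculation have "0 \<le> real m * t" "real m * t < real m * 1" by linarith+
    then have "t \<ge> 0" "t < 1" using m by (auto simp: zero_le_mult_iff)
    ultimately have "cell m (diag t) = i" "t \<in> {0..<1}"
      using m by (auto simp: diag_def clamp01_eq cell_def param_curve min_def nat_less_iff) linarith+
    then show "t \<in> {0..<1} \<inter> diag -` ?S" using diag_in by (simp add: space_diag_measure)
  qed
  then have "emeasure diag_measure ?S = emeasure lborel {real i / m..<(real i + 1) / m}"
    using emeasure_diag_measure[OF S] emeasure_unif[OF diag_vimage_borel[OF S]] by simp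
  also have "\<dots> = ennreal ((real i + 1) / m - real i / m)"
    by (subst emeasure_lborel_Ico) (auto intro: divide_right_mono)
  also have "(real i + 1) / m - real i / m = 1 / m" by (simp add: add_divide_distrib)
  finally show ?thesis .
qed

text \<open>If \<open>1 / m\<close> is smaller than the mass of a supposed atom, its part in each
  cell has too little mass to be the whole atom, hence mass zero; finitely many such parts cover
  it.\<close>

lemma nonatomic_diag_measure: "nonatomic diag_measure"
  unfolding nonatomic_def
proof (intro notI, elim bexE conjE)
  interpret prob_space diag_measure by (rule prob_space_diag_measure)
  fix S assume S: "S \<in> sets diag_measure" and pos: "emeasure diag_measure S > 0"
    and atom: "\<forall>B\<in>sets diag_measure. B \<subseteq> S \<longrightarrow> emeasure diag_measure B = 0 \<or> emeasure diag_measure B = emeasure diag_measure S"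
  have pos': "measure diag_measure S > 0" using pos by (simp add: emeasure_eq_measure)
  then obtain m where m: "m > 0" "1 / real m < measure diag_measure S"
    by (metis nat_approx_posE zero_less_Suc)
  define B where "B i = S \<inter> {p \<in> space diag_measure. cell m p = i}" for i
  have B: "B i \<in> sets diag_measure" for i
    unfolding B_def using cell_sets[of m "{i}"] by (intro sets.Int S) simp
  have "emeasure diag_measure (B i) = 0" if "i < m" for i
  proof -
    have "emeasure diag_measure (B i) \<le> ennreal (1 / m)"
      unfolding emeasure_cell[OF that, symmetric] using cell_sets[of m "{i}"]
      by (intro emeasure_mono) (auto simp: B_def)
    also have "\<dots> < emeasure diag_measure S"
      using m pos' unfolding emeasure_eq_measure by (intro ennreal_lessI) auto
    finally show ?thesis using atom B[of i] by (auto simp: B_def)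
  qed
  then have "(\<Sum>i<m. emeasure diag_measure (B i)) = 0" by simp
  moreover have "S \<subseteq> (\<Union>i<m. B i)"
    using sets.sets_into_space[OF S] cell_less[OF m(1)] by (auto simp: B_def)
  then have "emeasure diag_measure S \<le> (\<Sum>i<m. emeasure diag_measure (B i))"
    using B by (intro order_trans[OF emeasure_mono emeasure_subadditive_finite]) auto
  ultimately show False using pos by simp
qed

lemma AE_diag_measure: "AE p in diag_measure. \<exists>t\<in>{0..1}. p = (curve t, curve t)"
proof -
  let ?\<Gamma> = "diag ` {0..1}"
  have \<Gamma>: "?\<Gamma> \<in> sets diag_measure"
    using diag_in compact_continuous_image[OF continuous_on_subset[OF continuous_on_diag subset_UNIV]]
    by (intro compact_in_sets) blast+
  have "emeasure diag_measure (space diag_measure - ?\<Gamma>) = emeasure unif {}"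
  proof (subst emeasure_diag_measure)
    have "diag t \<in> ?\<Gamma>" for t
      using clamp01_in[of t] by (intro image_eqI[of _ _ "clamp01 t"]) (auto simp: diag_def clamp01_eq)
    then have "diag -` (space diag_measure - ?\<Gamma>) = {}" by blast
    then show "emeasure unif (diag -` (space diag_measure - ?\<Gamma>)) = emeasure unif {}" by simp
  qed (use \<Gamma> in auto)
  then have "space diag_measure - ?\<Gamma> \<in> null_sets diag_measure" using \<Gamma> by (auto intro: null_setsI)
  then show ?thesis
  proof (rule AE_I')
    show "{p \<in> space diag_measure. \<not> (\<exists>t\<in>{0..1}. p = (curve t, curve t))} \<subseteq> space diag_measure - ?\<Gamma>"
      by (auto simp: diag_def clamp01_eq)
  qed
qed

definition approx :: "nat \<Rightarrow> 'a \<times> 'a \<Rightarrow> (nat \<Rightarrow> ('a \<Rightarrow> 'a \<Rightarrow> 'k) \<Rightarrow> 'k) set" where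
  "approx m p = pt.hat.embed (sq (real (cell m p) / real m))"

lemma approx_simple: "pt.hat.simple_fun diag_measure (approx m)"
  unfolding pt.hat.simple_fun_def simple_function_def
proof (intro conjI ballI)
  have "finite (range (cell m))"
    by (rule finite_subset[of _ "{..m - 1}"]) (auto simp: cell_def)
  then have "finite ((\<lambda>i. pt.hat.embed (sq (real i / real m))) ` range (cell m))" by (rule finite_imageI)
  then show "finite (approx m ` space diag_measure)"
    by (rule rev_finite_subset) (auto simp: approx_def)
  show "approx m -` {a} \<inter> space diag_measure \<in> sets diag_measure" for a
    using cell_sets[of m "{i. pt.hat.embed (sq (real i / real m)) = a}"]
    by (simp add: approx_def vimage_def Int_def conj_commute)
  show "approx m ` space diag_measure \<subseteq> pt.hat.points"
    by (auto simp: approx_def intro: pt.hat.embed_in_points sq_in)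
qed

lemma approx_dist:
  assumes m: "m > 0" and t: "t \<in> {0..1}"
  shows "pt.hat.cdist (approx m (curve t, curve t)) (pt.elementary (curve t) (curve t)) \<le> 4 * D / m"
proof -
  let ?i = "cell m (curve t, curve t)"
  have "pt.hat.cdist (approx m (curve t, curve t)) (pt.elementary (curve t) (curve t))
      = pt.proj_norm (sq (real ?i / real m) - sq t)"
    using pt.hat.cdist_embed[OF sq_in sq_in, of "real ?i / real m" t]
    by (simp add: approx_def pt.elementary_def sq_def)
  also have "\<dots> \<le> 4 * D * \<bar>real ?i / real m - t\<bar>"
    by (rule sq_lipschitz[OF grid_in[OF cell_less[OF m]] t])
  also have "\<dots> \<le> 4 * D * (1 / m)"
    using C_ge cell_diag[OF m t] by (intro mult_left_mono) auto
  finally show ?thesis by simp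
qed

text \<open>\<open>simple_integral\<close> sums over distinct values, whereas \<open>riemann\<close>
  sums over cells. The grid tensors are distinct because the form with value
  \<open>g 1 x * g 0 y\<close> reads off \<open>i / m\<close>, and each occurs because a cell of
  mass \<open>1 / m\<close> is nonempty.\<close>

lemma simple_integral_approx:
  assumes m: "m > 0"
  shows "pt.hat.simple_integral diag_measure (approx m) = pt.hat.embed (riemann m)"
proof -
  define h where "h i = pt.hat.embed (sq (real i / real m))" for i :: nat
  have inj: "inj_on h {..<m}"
  proof (rule inj_onI)
    fix i j assume ij: "i \<in> {..<m}" "j \<in> {..<m}" and "h i = h j"
    let ?v = "sq (real i / real m) - sq (real j / real m)" and ?B = "\<lambda>x y. g 1 x * g 0 y"
    have "pt.proj_norm ?v = pt.hat.cdist (h j) (h j)"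
      using \<open>h i = h j\<close> pt.hat.cdist_embed[OF sq_in sq_in, of "real i / real m" "real j / real m"]
      by (simp add: h_def)
    also have "\<dots> = 0"
      using pt.hat.cdist_embed[OF sq_in sq_in, of "real j / real m" "real j / real m"]
      by (simp add: h_def pt.hat.p_zero)
    finally have "pt.proj_norm ?v = 0" .
    moreover obtain K where "\<And>v. v \<in> pt.alg_tensor \<Longrightarrow> norm (v ?B) \<le> K * pt.proj_norm v"
      using norm_apply_product_le[OF g_dual g_dual] by blast
    ultimately have "norm (?v ?B) \<le> 0"
      using pt.hat.diff_in[OF sq_in sq_in, of "real i / real m" "real j / real m"] by fastforce
    then have "(of_real (real i / real m) :: 'k) = of_real (real j / real m)"
      using ij by (simp add: sq_def pt.tensor_apply product_bilinear g_dual g_curve grid_in del: of_real_divide)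
    then show "i = j" using m unfolding of_real_eq_iff by simp
  qed
  have image: "approx m ` space diag_measure = h ` {..<m}"
  proof (intro equalityI subsetI)
    fix a assume "a \<in> h ` {..<m}"
    then obtain i where i: "i < m" "a = h i" by auto
    have "{p \<in> space diag_measure. cell m p = i} \<noteq> {}"
    proof
      assume empty: "{p \<in> space diag_measure. cell m p = i} = {}"
      have "ennreal (1 / m) = 0" using emeasure_cell[OF i(1)] unfolding empty by simp
      then show False using m by (simp add: ennreal_eq_0_iff)
    qed
    then show "a \<in> approx m ` space diag_measure" using i by (auto simp: approx_def h_def)
  qed (auto simp: approx_def h_def cell_less[OF m])
  have fibre: "measure diag_measure (approx m -` {h i} \<inter> space diag_measure) = 1 / m" if "i < m" for i
  proof -
    have "approx m -` {h i} \<inter> space diag_measure = {p \<in> space diag_measure. cell m p = i}"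
      using inj_onD[OF inj, of "cell m _" i] cell_less[OF m] that
      by (auto simp: approx_def h_def[symmetric])
    then show ?thesis using emeasure_cell[OF that] by (simp add: measure_def)
  qed
  have "pt.hat.simple_integral diag_measure (approx m) = pt.hat.lincomb {..<m} (\<lambda>i. of_real (1 / m)) h"
    unfolding pt.hat.simple_integral_def pt.hat.lincomb_def image
    by (simp add: sum.reindex[OF inj] fibre cong: sum.cong_simp)
  also have "\<dots> = pt.hat.embed (riemann m)"
    unfolding h_def riemann_def by (rule pt.hat.lincomb_embed) (rule sq_in)
  finally show ?thesis .
qed

lemma witnesses_curve_tensor: "pt.witnesses diag_measure curve_tensor"
proof -
  interpret prob_space diag_measure by (rule prob_space_diag_measure)
  let ?f = "\<lambda>(x, y). pt.elementary x y"
  \<comment> \<open>The index is shifted because the cell estimates hold for positive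
    \<open>m\<close>.\<close>
  have lim: "(\<lambda>m. 4 * D / real (Suc m)) \<longlonglongrightarrow> 0"
    using LIMSEQ_Suc[OF lim_const_over_n] by blast
  have conv: "AE p in diag_measure. (\<lambda>m. pt.hat.cdist (approx (Suc m) p) (?f p)) \<longlonglongrightarrow> 0"
    using AE_diag_measure
  proof eventually_elim
    case (elim p)
    then obtain t where t: "t \<in> {0..1}" "p = (curve t, curve t)" by auto
    have nonneg: "pt.hat.cdist (approx (Suc m) p) (?f p) \<ge> 0" for m
      using pt.hat.cdist_embed[OF sq_in sq_in] pt.hat.p_nonneg[OF pt.hat.diff_in[OF sq_in sq_in]]
      by (simp add: approx_def t pt.elementary_def sq_def[symmetric])
    have le: "pt.hat.cdist (approx (Suc m) p) (?f p) \<le> 4 * D / real (Suc m)" for m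
      using approx_dist[OF _ t(1), of "Suc m"] t(2) by simp
    show ?case
      by (rule tendsto_sandwich[OF always_eventually always_eventually tendsto_const lim])
        (use nonneg le in blast)+
  qed
  have int: "(\<integral>\<^sup>+p. ennreal (pt.hat.cdist (approx (Suc m) p) (?f p)) \<partial>diag_measure) \<le> ennreal (4 * D / real (Suc m))" for m
  proof -
    have "AE p in diag_measure. ennreal (pt.hat.cdist (approx (Suc m) p) (?f p)) \<le> ennreal (4 * D / real (Suc m))"
      using AE_diag_measure
    proof eventually_elim
      case (elim p)
      then show ?case using approx_dist[of "Suc m"] by (auto intro!: ennreal_leI)
    qed
    then have "(\<integral>\<^sup>+p. ennreal (pt.hat.cdist (approx (Suc m) p) (?f p)) \<partial>diag_measure)
        \<le> (\<integral>\<^sup>+p. ennreal (4 * D / real (Suc m)) \<partial>diag_measure)"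
      by (rule nn_integral_mono_AE)
    then show ?thesis by (simp add: emeasure_space_1)
  qed
  have int_lim: "(\<lambda>m. \<integral>\<^sup>+p. ennreal (pt.hat.cdist (approx (Suc m) p) (?f p)) \<partial>diag_measure) \<longlonglongrightarrow> 0"
  proof (rule tendsto_sandwich[OF _ _ tendsto_const])
    show "(\<lambda>m. ennreal (4 * D / real (Suc m))) \<longlonglongrightarrow> 0"
      using tendsto_ennrealI[OF lim] by simp
  qed (use int in auto)
  have "pt.hat.has_bochner diag_measure ?f curve_tensor"
    unfolding pt.hat.has_bochner_def pt.hat.strongly_measurable_def
  proof (intro conjI exI[of _ "\<lambda>m. approx (Suc m)"] allI approx_simple conv int_lim curve_tensor_in)
    show "?f ` space diag_measure \<subseteq> pt.hat.points"
      by (auto simp: pt.elementary_def intro: pt.hat.embed_in_points pt.tensor_in)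
    show "(\<lambda>m. pt.hat.cdist (pt.hat.simple_integral diag_measure (approx (Suc m))) curve_tensor) \<longlonglongrightarrow> 0"
      using LIMSEQ_Suc[OF pt.hat.cdist_embed_cls_tendsto[OF riemann_cauchy]]
      by (simp add: simple_integral_approx curve_tensor_def)
  qed
  moreover have "measure diag_measure balls = 1"
    using prob_space by (simp add: space_diag_measure)
  ultimately show ?thesis
    unfolding pt.witnesses_def
    by (simp add: sets_diag_measure cnorm_curve_tensor finite_measure_axioms)
qed

end

subsection \<open>No norm-attaining series\<close>

lemma card_grid_near:
  fixes a \<eta> :: real
  assumes "\<eta> > 0"
  shows "real (card {i. i < k \<and> \<bar>real i / real k - a\<bar> < \<eta>}) \<le> 2 * \<eta> * real k + 1"
proof -
  let ?S = "{i. i < k \<and> \<bar>real i / real k - a\<bar> < \<eta>}"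
  show ?thesis
  proof (cases "?S = {}")
    case False
    have fin: "finite ?S" by simp
    have "Min ?S \<in> ?S" "Max ?S \<in> ?S" using False fin by (intro Min_in Max_in; simp)+
    then have k: "k > 0" and "\<bar>real (Min ?S) / real k - a\<bar> < \<eta>" "\<bar>real (Max ?S) / real k - a\<bar> < \<eta>" by auto
    then have "real (Max ?S) / real k - real (Min ?S) / real k < 2 * \<eta>" by linarith
    then have "real (Max ?S) - real (Min ?S) < 2 * \<eta> * real k"
      using k by (simp add: field_simps)
    moreover have "card ?S \<le> card {Min ?S..Max ?S}"
      using fin by (intro card_mono) auto
    then have "real (card ?S) \<le> real (Max ?S) - real (Min ?S) + 1"
      using Min_le[OF fin Max_in[OF fin False]] by (simp add: of_nat_diff)
    ultimately show ?thesis by linarith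
  next
    case True
    show ?thesis unfolding True using assms by simp
  qed
qed

text \<open>The bump is at most 1 within \<open>\<eta>\<close> of \<open>a\<close>, where about a
  fraction \<open>2 * \<eta>\<close> of the grid lies, and at most \<open>(1 - \<eta>^2) ^ j\<close>
  elsewhere.\<close>

lemma average_bump_le:
  fixes a \<eta> :: real
  assumes a: "a \<in> {0..1}" and \<eta>: "0 < \<eta>" "\<eta> < 1" and k: "k > 0"
  shows "(\<Sum>i<k. 1 / real k * (1 - (real i / real k - a)\<^sup>2) ^ j) \<le> 2 * \<eta> + 1 / real k + (1 - \<eta>\<^sup>2) ^ j"
proof -
  have \<eta>2: "0 \<le> 1 - \<eta>\<^sup>2" using \<eta> by (simp add: power_le_one)
  have "(1 - (t - a)\<^sup>2) ^ j \<le> (if \<bar>t - a\<bar> < \<eta> then 1 else 0) + (1 - \<eta>\<^sup>2) ^ j" if "t \<in> {0..1}" for t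
  proof -
    have sq: "0 \<le> 1 - (t - a)\<^sup>2" using that a abs_square_le_1[of "t - a"] by auto
    show ?thesis
    proof (cases "\<bar>t - a\<bar> < \<eta>")
      case True
      then show ?thesis using power_le_one[OF sq, of j] zero_le_power[OF \<eta>2, of j] by simp
    next
      case False
      then have "\<eta>\<^sup>2 \<le> (t - a)\<^sup>2" using \<eta> abs_le_square_iff[of \<eta> "t - a"] by simp
      then show ?thesis using False sq by (simp add: power_mono)
    qed
  qed
  then have "(1 - (real i / real k - a)\<^sup>2) ^ j \<le> (if \<bar>real i / real k - a\<bar> < \<eta> then 1 else 0) + (1 - \<eta>\<^sup>2) ^ j"
    if "i < k" for i
    using that by (auto simp: divide_le_eq_1)
  then have "(\<Sum>i<k. 1 / real k * (1 - (real i / real k - a)\<^sup>2) ^ j)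
      \<le> (\<Sum>i<k. 1 / real k * ((if \<bar>real i / real k - a\<bar> < \<eta> then 1 else 0) + (1 - \<eta>\<^sup>2) ^ j))"
    by (intro sum_mono mult_left_mono) auto
  also have "\<dots> = 1 / real k * real (card {i. i < k \<and> \<bar>real i / real k - a\<bar> < \<eta>}) + (1 - \<eta>\<^sup>2) ^ j"
  proof -
    have "(\<Sum>i<k. if \<bar>real i / real k - a\<bar> < \<eta> then 1 else 0 :: real)
        = real (card {i. i < k \<and> \<bar>real i / real k - a\<bar> < \<eta>})"
      by (simp add: sum.If_cases Int_def)
    then show ?thesis unfolding sum_distrib_left[symmetric] sum.distrib using k by (simp add: field_simps)
  qed
  also have "\<dots> \<le> 1 / real k * (2 * \<eta> * real k + 1) + (1 - \<eta>\<^sup>2) ^ j"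
    by (intro add_right_mono mult_left_mono card_grid_near \<eta>) auto
  also have "\<dots> = 2 * \<eta> + 1 / real k + (1 - \<eta>\<^sup>2) ^ j" using k by (simp add: field_simps)
  finally show ?thesis .
qed

context moment_curve
begin

lemma poly_functional:
  obtains f where "f \<in> dual" "\<And>t. t \<in> {0..1} \<Longrightarrow> f (curve t) = of_real (poly q t)"
proof (rule that[of "\<lambda>x. \<Sum>i\<le>degree q. of_real (coeff q i) * g i x"])
  show "(\<lambda>x. \<Sum>i\<le>degree q. of_real (coeff q i) * g i x) \<in> dual"
    by (intro sum_in_dual scale_in_dual g_dual)
qed (simp add: g_curve poly_altdef)

lemma inner_one_eq_one:
  fixes a :: 'k
  assumes "norm a \<le> 1" "inner a 1 = 1"
  shows "a = 1"
proof -
  have "(norm (a - 1))\<^sup>2 = (norm a)\<^sup>2 - 2 * inner a 1 + (norm (1::'k))\<^sup>2"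
    unfolding power2_norm_eq_inner by (simp add: inner_diff_left inner_diff_right inner_commute)
  also have "\<dots> \<le> 0" using assms by (simp add: power_le_one)
  finally show ?thesis by simp
qed

text \<open>Taking real parts, the nonnegative terms \<open>l n * (1 - inner (a n) 1)\<close> sum to
  zero. So each \<open>a n\<close> of positive weight has real part 1, and modulus at most one
  leaves only \<open>a n = 1\<close>.\<close>

lemma optimal_terms_attain:
  fixes a :: "nat \<Rightarrow> 'k"
  assumes a: "\<And>n. norm (a n) \<le> 1" and l: "\<And>n. l n \<ge> 0" "l sums 1"
    and sums: "(\<lambda>n. of_real (l n) * a n) sums 1" and n: "l n > 0"
  shows "a n = 1"
proof -
  have "(\<lambda>n. inner (of_real (l n) * a n) 1) sums inner 1 (1::'k)"
    by (rule bounded_linear.sums[OF bounded_linear_inner_left sums])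
  moreover have "inner (of_real (l n) * a n) 1 = l n * inner (a n) 1" for n
    by (simp flip: scaleR_conv_of_real)
  ultimately have "(\<lambda>n. l n - l n * inner (a n) 1) sums (1 - 1)"
    by (intro sums_diff l) (simp add: dot_square_norm)
  then have sum0: "(\<lambda>n. l n * (1 - inner (a n) 1)) sums 0" by (simp add: algebra_simps)
  have "inner (a n) 1 \<le> 1" for n
    using norm_cauchy_schwarz[of "a n" 1] a[of n] by simp
  then have "l n * (1 - inner (a n) 1) \<ge> 0" for n using l(1) by simp
  then have "l n * (1 - inner (a n) 1) = 0"
    using suminf_eq_zero_iff[OF sums_summable[OF sum0]] sum0 by (simp add: sums_iff)
  then show ?thesis using n a by (intro inner_one_eq_one) auto
qed

theorem curve_tensor_not_NA: "curve_tensor \<notin> pt.NA"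
proof
  assume "curve_tensor \<in> pt.NA"
  then have "\<exists>(l :: nat \<Rightarrow> real) x y. (\<forall>n. x n \<in> unit_ball N \<and> y n \<in> unit_ball N \<and> l n \<ge> 0) \<and>
     (\<lambda>m. pt.hat.cdist (pt.hat.lincomb {..<m} (\<lambda>n. of_real (l n)) (\<lambda>n. pt.elementary (x n) (y n))) curve_tensor)
       \<longlonglongrightarrow> 0 \<and> l sums pt.hat.cnorm curve_tensor"
    unfolding pt.NA_def mem_Collect_eq by (rule conjunct2)
  then obtain l :: "nat \<Rightarrow> real" and x y
    where balls: "\<forall>n. x n \<in> unit_ball N \<and> y n \<in> unit_ball N \<and> l n \<ge> 0"
    and lim: "(\<lambda>m. pt.hat.cdist (pt.hat.lincomb {..<m} (\<lambda>n. of_real (l n)) (\<lambda>n. pt.elementary (x n) (y n))) curve_tensor)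
       \<longlonglongrightarrow> 0"
    and l1: "l sums pt.hat.cnorm curve_tensor"
    by (elim exE conjE) (rule that)
  note l1 = l1[unfolded cnorm_curve_tensor]
  have xy: "N (x n) \<le> 1" "N (y n) \<le> 1" and l: "l n \<ge> 0" for n
    using balls by (simp_all add: unit_ball_def)
  define w where "w m = (\<Sum>n<m. pt.tensor_scale (of_real (l n)) (pt.tensor (x n) (y n)))" for m
  have w_in: "w m \<in> pt.alg_tensor" for m
    unfolding w_def by (intro pt.hat.sum_in pt.hat.scale_in pt.tensor_in)
  have w_apply: "w m B = (\<Sum>n<m. of_real (l n) * B (x n) (y n))" if "B \<in> pt.bilinear_forms" for m B
    using that by (simp add: w_def pt.sum_apply pt.tensor_scale_def pt.tensor_apply)
  define \<delta> where "\<delta> m = pt.hat.cdist (pt.hat.embed (w m)) curve_tensor" for m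
  have "pt.hat.lincomb {..<m} (\<lambda>n. of_real (l n)) (\<lambda>n. pt.elementary (x n) (y n)) = pt.hat.embed (w m)" for m
    unfolding pt.elementary_def w_def by (rule pt.hat.lincomb_embed) (rule pt.tensor_in)
  then have \<delta>: "\<delta> \<longlonglongrightarrow> 0" using lim by (simp add: \<delta>_def[abs_def])
  \<comment> \<open>Distances to the class are limits of distances to Riemann sums, so bilinear
    forms need to be evaluated on algebraic tensors only.\<close>
  have dist: "(\<lambda>k. pt.proj_norm (w m - riemann k)) \<longlonglongrightarrow> \<delta> m" for m
    unfolding \<delta>_def curve_tensor_def by (rule pt.hat.cdist_embed_cls[OF w_in riemann_cauchy])

  \<comment> \<open>The form \<open>A\<close> is 1 on every Riemann sum, so testing with it forces
    every term of positive weight to be a contact pair.\<close>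
  have "(\<lambda>m. w m A - 1) \<longlonglongrightarrow> 0"
  proof (rule Lim_null_comparison[OF always_eventually \<delta>], rule allI)
    fix m
    have "norm (w m A - 1) \<le> pt.proj_norm (w m - riemann k)" if "k > 0" for k
      using norm_apply_A_le[OF pt.hat.diff_in[OF w_in riemann_in], of m k] riemann_A[OF that] by simp
    then show "norm (w m A - 1) \<le> \<delta> m"
      by (intro LIMSEQ_le_const[OF dist]) (metis less_eq_Suc_le)
  qed
  from LIM_zero_cancel[OF this] have A_sums: "(\<lambda>n. of_real (l n) * A (x n) (y n)) sums 1"
    unfolding sums_def w_apply[OF A_bilinear] .
  have A_le: "norm (A (x n) (y n)) \<le> 1" for n
    using norm_A_le_N[of "x n" "y n"] mult_mono[OF xy, of n n] N_nonneg by (auto intro: order_trans)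
  have "\<exists>s\<in>{0..1}. \<forall>f\<in>dual. \<forall>h\<in>dual. f (x n) * h (y n) = f (curve s) * h (curve s)" if "l n > 0" for n
    using contact_on_curve[OF xy optimal_terms_attain[OF A_le l l1 A_sums that]] by metis
  then obtain s where s: "\<And>n. l n > 0 \<Longrightarrow> s n \<in> {0..1}"
    "\<And>n f h. l n > 0 \<Longrightarrow> f \<in> dual \<Longrightarrow> h \<in> dual \<Longrightarrow> f (x n) * h (y n) = f (curve (s n)) * h (curve (s n))"
    by metis
  have "\<exists>n. l n > 0"
  proof (rule ccontr)
    assume "\<nexists>n. l n > 0"
    then have "l = (\<lambda>_. 0)" using l by (auto simp: fun_eq_iff not_less intro: antisym)
    then show False using l1 sums_unique2[OF sums_zero] by fastforce
  qed
  then obtain n0 where n0: "l n0 > 0" by blast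
  define a where "a = s n0"
  have a: "a \<in> {0..1}" using s(1)[OF n0] by (simp add: a_def)

  have key: "l n0 \<le> 2 * \<eta> + (1 - \<eta>\<^sup>2) ^ j" if \<eta>: "0 < \<eta>" "\<eta> < 1" for \<eta> j
  proof -
    obtain f where f: "f \<in> dual" "\<And>t. t \<in> {0..1} \<Longrightarrow> f (curve t) = of_real (poly ([:1 - a\<^sup>2, 2 * a, - 1:] ^ j) t)"
      using poly_functional by blast
    have bump: "f (curve t) = of_real ((1 - (t - a)\<^sup>2) ^ j)" if "t \<in> {0..1}" for t
    proof -
      have "poly [:1 - a\<^sup>2, 2 * a, - 1:] t = 1 - (t - a)\<^sup>2"
        by (simp add: power2_eq_square algebra_simps)
      then show ?thesis by (simp only: f(2)[OF that] poly_power)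
    qed
    \<comment> \<open>On the diagonal of the curve the factor \<open>g 0\<close> is 1, so
      \<open>B\<close> reads off the bump alone.\<close>
    define B where "B = (\<lambda>x y. f x * g 0 y)"
    have B: "B \<in> pt.bilinear_forms" unfolding B_def by (rule product_bilinear[OF f(1) g_dual])
    obtain K where K: "K \<ge> 0" "\<And>v. v \<in> pt.alg_tensor \<Longrightarrow> norm (v B) \<le> K * pt.proj_norm v"
      using norm_apply_product_le[OF f(1) g_dual] unfolding B_def by blast
    have B_curve: "B (curve t) (curve t) = of_real ((1 - (t - a)\<^sup>2) ^ j)" if "t \<in> {0..1}" for t
      using that by (simp add: B_def bump g_curve del: of_real_power)
    have summand: "of_real (l n) * B (x n) (y n) = (of_real (l n * (1 - (s n - a)\<^sup>2) ^ j) :: 'k)" for n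
    proof (cases "l n > 0")
      case True
      have "B (x n) (y n) = B (curve (s n)) (curve (s n))"
        unfolding B_def by (rule s(2)[OF True f(1) g_dual])
      then show ?thesis using B_curve[OF s(1)[OF True]] by (simp del: of_real_power)
    qed (use l[of n] in simp)
    have w_B: "w m B = of_real (\<Sum>n<m. l n * (1 - (s n - a)\<^sup>2) ^ j)" for m
      by (simp only: w_apply[OF B] summand of_real_sum)
    have nonneg: "l n * (1 - (s n - a)\<^sup>2) ^ j \<ge> 0" for n
    proof (cases "l n > 0")
      case True
      then show ?thesis using square_le_one[OF s(1)[OF True] a] by simp
    qed (use l[of n] in simp)
    \<comment> \<open>The bump is 1 at \<open>a\<close> and the remaining terms are nonnegative, so
      the weight of the atom is never lost.\<close>
    have w_ge: "l n0 \<le> norm (w m B)" if "m > n0" for m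
    proof -
      have "l n0 = l n0 * (1 - (s n0 - a)\<^sup>2) ^ j" by (simp add: a_def)
      also have "\<dots> \<le> (\<Sum>n<m. l n * (1 - (s n - a)\<^sup>2) ^ j)"
        using that nonneg by (intro member_le_sum) auto
      also have "\<dots> \<le> norm (w m B)" unfolding w_B norm_of_real by simp
      finally show ?thesis .
    qed
    have riemann_le: "norm (riemann k B) \<le> 2 * \<eta> + 1 / real k + (1 - \<eta>\<^sup>2) ^ j" if k: "k > 0" for k
    proof -
      have "riemann k B = (\<Sum>i<k. of_real (1 / real k * (1 - (real i / real k - a)\<^sup>2) ^ j))"
        unfolding riemann_apply[OF B] by (intro sum.cong) (simp_all only: B_curve grid_in lessThan_iff of_real_mult)
      also have "\<dots> = of_real (\<Sum>i<k. 1 / real k * (1 - (real i / real k - a)\<^sup>2) ^ j)" by (simp only: of_real_sum)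
      finally have eq: "riemann k B = of_real (\<Sum>i<k. 1 / real k * (1 - (real i / real k - a)\<^sup>2) ^ j)" .
      have "(\<Sum>i<k. 1 / real k * (1 - (real i / real k - a)\<^sup>2) ^ j) \<ge> 0"
        by (intro sum_nonneg mult_nonneg_nonneg zero_le_power)
          (use square_le_one[OF grid_in a] in auto)
      then show ?thesis unfolding eq norm_of_real using average_bump_le[OF a \<eta> k, of j] by linarith
    qed
    \<comment> \<open>First the Riemann index \<open>k\<close> tends to infinity for fixed
      \<open>m\<close>; afterwards \<open>m\<close> does, which removes the error
      \<open>K * \<delta> m\<close>.\<close>
    have "l n0 \<le> 2 * \<eta> + (1 - \<eta>\<^sup>2) ^ j + K * \<delta> m" if m: "m > n0" for m
    proof (rule LIMSEQ_le_const)
      have "(\<lambda>k. 2 * \<eta> + 1 / real k + (1 - \<eta>\<^sup>2) ^ j + K * pt.proj_norm (w m - riemann k))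
          \<longlonglongrightarrow> 2 * \<eta> + 0 + (1 - \<eta>\<^sup>2) ^ j + K * \<delta> m"
        by (intro tendsto_intros dist lim_const_over_n)
      then show "(\<lambda>k. 2 * \<eta> + 1 / real k + (1 - \<eta>\<^sup>2) ^ j + K * pt.proj_norm (w m - riemann k))
          \<longlonglongrightarrow> 2 * \<eta> + (1 - \<eta>\<^sup>2) ^ j + K * \<delta> m" by simp
      have "l n0 \<le> 2 * \<eta> + 1 / real k + (1 - \<eta>\<^sup>2) ^ j + K * pt.proj_norm (w m - riemann k)" if k: "k > 0" for k
      proof -
        have "norm (w m B - riemann k B) \<le> K * pt.proj_norm (w m - riemann k)"
          using K(2)[OF pt.hat.diff_in[OF w_in riemann_in]] by simp
        then show ?thesis
          using w_ge[OF m] riemann_le[OF k] norm_triangle_sub[of "w m B" "riemann k B"] by linarith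
      qed
      then show "\<exists>M. \<forall>k\<ge>M. l n0 \<le> 2 * \<eta> + 1 / real k + (1 - \<eta>\<^sup>2) ^ j + K * pt.proj_norm (w m - riemann k)"
        by (metis less_eq_Suc_le)
    qed
    moreover have "(\<lambda>m. 2 * \<eta> + (1 - \<eta>\<^sup>2) ^ j + K * \<delta> m) \<longlonglongrightarrow> 2 * \<eta> + (1 - \<eta>\<^sup>2) ^ j + K * 0"
      by (intro tendsto_intros \<delta>)
    ultimately have "l n0 \<le> 2 * \<eta> + (1 - \<eta>\<^sup>2) ^ j + K * 0"
      by (intro LIMSEQ_le_const[where a = "l n0"]) (auto intro!: exI[of _ "Suc n0"])
    then show ?thesis by simp
  qed
  have "l n0 \<le> 1"
    using sum_le_suminf[OF sums_summable[OF l1], of "{n0}"] l sums_unique[OF l1] by simp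
  \<comment> \<open>As \<open>j\<close> grows the bound in \<open>key\<close> tends to
    \<open>2 * \<eta>\<close>, which is only half of \<open>l n0\<close>.\<close>
  define \<eta> where "\<eta> = l n0 / 4"
  have \<eta>: "0 < \<eta>" "\<eta> < 1" using n0 \<open>l n0 \<le> 1\<close> by (simp_all add: \<eta>_def)
  have "0 \<le> 1 - \<eta>\<^sup>2" using \<eta> by (simp add: power_le_one)
  then have "(\<lambda>j. 2 * \<eta> + (1 - \<eta>\<^sup>2) ^ j) \<longlonglongrightarrow> 2 * \<eta> + 0"
    using \<eta> by (intro tendsto_intros LIMSEQ_realpow_zero) auto
  then have "l n0 \<le> 2 * \<eta> + 0" using key[OF \<eta>] by (intro LIMSEQ_le_const) auto
  then show False using n0 by (simp add: \<eta>_def)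
qed

end

section \<open>The renorming for both scalar fields\<close>

lemma (in scalar_banach) renorming_exists:
  assumes inf: "infinite_dim sc" and norm_sc: "\<And>c x. norm (sc c x) = norm c * norm x"
    and norming: "\<And>x. \<exists>f\<in>dual. (\<forall>z. norm (f z) \<le> 2 * norm z) \<and> norm (f x) \<ge> norm x"
  shows "\<exists>N :: 'a \<Rightarrow> real. is_norm sc N \<and> equivalent_norms norm N \<and>
    (\<exists>u M. u \<in> projective_tensor.INA sc N sc N - projective_tensor.NA sc N sc N \<and>
      projective_tensor.witnesses sc N sc N M u \<and> prob_space M \<and> nonatomic M \<and>
      radon_measure (projective_tensor.ball_topology N N) M)"
proof -
  have separating: "\<exists>f\<in>dual. f x \<noteq> 0" if "x \<noteq> 0" for x
  proof -
    obtain f where "f \<in> dual" "norm (f x) \<ge> norm x" using norming by blast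
    moreover have "norm x > 0" using that by simp
    ultimately show ?thesis by (intro bexI[of _ f]) auto
  qed
  have pos: "(1/2) ^ n / (real n + 1) > 0" for n by simp
  obtain e :: "nat \<Rightarrow> 'a" and g :: "nat \<Rightarrow> 'a \<Rightarrow> 'k" where g: "\<And>n. g n \<in> dual"
    and e: "\<And>n. norm (e n) \<le> (1/2) ^ n / (n + 1)" and biorth: "\<And>i j. g i (e j) = (if i = j then 1 else 0)"
    by (rule biorthogonal_system_exists[where b = "\<lambda>n. (1/2) ^ n / (real n + 1)", OF inf separating pos])
      (assumption, rule that)
  have "\<forall>i. \<exists>E. \<forall>z. norm (g i z) \<le> E * norm z" using g by (auto simp: dual_def)
  then obtain E where E: "\<And>i z. norm (g i z) \<le> E i * norm z" by metis
  define C where "C = 1 + \<bar>E 0\<bar> + \<bar>E 1\<bar> + \<bar>E 2\<bar>"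
  have bound: "norm (g i z) \<le> C * norm z" if "i \<le> 2" for i z
  proof -
    have "i = 0 \<or> i = 1 \<or> i = 2" using that by auto
    then have "E i \<le> C" by (auto simp: C_def)
    then show ?thesis using E[of i z] mult_right_mono[of "E i" C "norm z"] by simp
  qed
  interpret moment_curve sc e g C
    by unfold_locales (use norm_sc norming g e biorth bound in \<open>auto simp: C_def\<close>)
  have "curve_tensor \<in> pt.INA - pt.NA"
    using curve_tensor_in witnesses_curve_tensor curve_tensor_not_NA unfolding pt.INA_def by blast
  then show ?thesis
    using is_norm_N equivalent_norms_N witnesses_curve_tensor prob_space_diag_measure
      nonatomic_diag_measure radon_diag_measure by blast
qed

text \<open>The usual complexification of a real norming functional. The factor 2 comes from
  bounding the modulus by real plus imaginary part, and is absorbed by the constant in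
  \<open>N_ge\<close>.\<close>

lemma complex_norming_functional:
  fixes sc :: "complex \<Rightarrow> 'a::banach \<Rightarrow> 'a" and x0 :: 'a
  assumes "complex_banach sc"
  obtains F where "\<And>x y. F (x + y) = F x + F y" "\<And>c x. F (sc c x) = c * F x"
    "\<And>z. norm (F z) \<le> 2 * norm z" "norm (F x0) \<ge> norm x0"
proof -
  interpret vector_space sc using assms by (simp add: complex_banach_def)
  have real: "sc (complex_of_real r) x = r *\<^sub>R x" and norm_sc: "norm (sc c x) = norm c * norm x" for r c x
    using assms by (auto simp: complex_banach_def is_norm_def)
  obtain f :: "'a \<Rightarrow> real" where f: "linear f" "\<And>x. \<bar>f x\<bar> \<le> norm x" "f x0 = norm x0"
    using hahn_banach_norming[of x0] by blast
  define F where "F x = Complex (f x) (- f (sc \<i> x))" for x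
  show ?thesis
  proof (rule that[of F])
    show "F (x + y) = F x + F y" for x y
      by (simp add: F_def complex_eq_iff linear_add[OF f(1)] scale_right_distrib)
    show "F (sc c x) = c * F x" for c x
    proof -
      have c: "sc c x = Re c *\<^sub>R x + Im c *\<^sub>R sc \<i> x"
      proof -
        have "sc c x = sc (complex_of_real (Re c) + complex_of_real (Im c) * \<i>) x"
          by (simp add: complex_eq_iff)
        then show ?thesis by (simp only: scale_left_distrib real flip: scale_scale)
      qed
      have "sc \<i> (sc c x) = sc (complex_of_real (Re c) * \<i> + complex_of_real (- Im c)) x"
        by (simp add: complex_eq_iff)
      also have "\<dots> = Re c *\<^sub>R sc \<i> x + (- Im c) *\<^sub>R x"
        by (simp only: scale_left_distrib real flip: scale_scale)
      finally have ic: "sc \<i> (sc c x) = Re c *\<^sub>R sc \<i> x + (- Im c) *\<^sub>R x" .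
      show ?thesis
        unfolding F_def ic unfolding c
        by (simp add: complex_eq_iff linear_add[OF f(1)] linear_diff[OF f(1)] linear_scale[OF f(1)])
    qed
    show "norm (F z) \<le> 2 * norm z" for z
    proof -
      have "norm (F z) \<le> \<bar>f z\<bar> + \<bar>f (sc \<i> z)\<bar>"
        using cmod_le[of "F z"] by (simp add: F_def)
      then show ?thesis using f(2)[of z] f(2)[of "sc \<i> z"] norm_sc[of \<i> z] by simp
    qed
    show "norm (F x0) \<ge> norm x0"
      using abs_Re_le_cmod[of "F x0"] f(3) by (simp add: F_def)
  qed
qed

theorem corollary2:
  shows
    "(infinite_dim (scaleR :: real \<Rightarrow> 'a::banach \<Rightarrow> 'a) \<longrightarrow>
       (\<exists>N :: 'a \<Rightarrow> real. is_norm scaleR N \<and> equivalent_norms norm N \<and>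
         (\<exists>u M. u \<in> projective_tensor.INA scaleR N scaleR N - projective_tensor.NA scaleR N scaleR N \<and>
           projective_tensor.witnesses scaleR N scaleR N M u \<and>
           prob_space M \<and> nonatomic M \<and>
           radon_measure (projective_tensor.ball_topology N N) M)))
     \<and>
     (\<forall>sc :: complex \<Rightarrow> 'b::banach \<Rightarrow> 'b. complex_banach sc \<and> infinite_dim sc \<longrightarrow>
       (\<exists>N :: 'b \<Rightarrow> real. is_norm sc N \<and> equivalent_norms norm N \<and>
         (\<exists>u M. u \<in> projective_tensor.INA sc N sc N - projective_tensor.NA sc N sc N \<and>
           projective_tensor.witnesses sc N sc N M u \<and>
           prob_space M \<and> nonatomic M \<and>
           radon_measure (projective_tensor.ball_topology N N) M)))"
proof (intro conjI impI allI)
  assume inf: "infinite_dim (scaleR :: real \<Rightarrow> 'a \<Rightarrow> 'a)"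
  interpret scalar_banach "scaleR :: real \<Rightarrow> 'a \<Rightarrow> 'a"
    by unfold_locales (auto simp: algebra_simps)
  have norming: "\<exists>f\<in>dual. (\<forall>z. norm (f z) \<le> 2 * norm z) \<and> norm (f x) \<ge> norm x" for x
  proof -
    obtain f :: "'a \<Rightarrow> real" where f: "linear f" "\<And>x. \<bar>f x\<bar> \<le> norm x" "f x = norm x"
      using hahn_banach_norming[of x] by blast
    have "norm (f z) \<le> 2 * norm z" for z using f(2)[of z] norm_ge_zero[of z] by simp
    then show ?thesis
      using f by (intro bexI[of _ f] dualI) (auto simp: linear_add linear_scale)
  qed
  show "\<exists>N :: 'a \<Rightarrow> real. is_norm scaleR N \<and> equivalent_norms norm N \<and>
    (\<exists>u M. u \<in> projective_tensor.INA scaleR N scaleR N - projective_tensor.NA scaleR N scaleR N \<and>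
      projective_tensor.witnesses scaleR N scaleR N M u \<and> prob_space M \<and> nonatomic M \<and>
      radon_measure (projective_tensor.ball_topology N N) M)"
    by (rule renorming_exists[OF inf _ norming]) simp
next
  fix sc :: "complex \<Rightarrow> 'b \<Rightarrow> 'b"
  assume "complex_banach sc \<and> infinite_dim sc"
  then have sc: "complex_banach sc" and inf: "infinite_dim sc" by auto
  interpret scalar_banach sc
    using sc by (auto simp: scalar_banach_def complex_banach_def)
  have norming: "\<exists>f\<in>dual. (\<forall>z. norm (f z) \<le> 2 * norm z) \<and> norm (f x) \<ge> norm x" for x
  proof -
    obtain f where f: "\<And>x y. f (x + y) = f x + f y" "\<And>c x. f (sc c x) = c * f x"
      "\<And>z. norm (f z) \<le> 2 * norm z" "norm (f x) \<ge> norm x"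
      using complex_norming_functional[OF sc, of x] by blast
    have "f \<in> dual" by (rule dualI[OF f(1-3)])
    then show ?thesis using f by blast
  qed
  show "\<exists>N :: 'b \<Rightarrow> real. is_norm sc N \<and> equivalent_norms norm N \<and>
    (\<exists>u M. u \<in> projective_tensor.INA sc N sc N - projective_tensor.NA sc N sc N \<and>
      projective_tensor.witnesses sc N sc N M u \<and> prob_space M \<and> nonatomic M \<and>
      radon_measure (projective_tensor.ball_topology N N) M)"
    by (rule renorming_exists[OF inf _ norming]) (use sc in \<open>auto simp: complex_banach_def is_norm_def\<close>)
qed

end
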